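(* Let $\tau>0$ and consider the delay differential-algebraic equation (DDAE) $F(t,x,\dot x,\sigma_{-\tau}x)=0$ with scalar equations $F_1,\dots,F_M$ and unknown $x=(x_1,\dots,x_n)$, where $(\sigma_{k\tau}f)(t)=f(t+k\tau)$. Let $\Theta$ be the set of those variables among $x_i,\dot x_i,\sigma_{-\tau}x_i$ ($i=1,\dots,n$) that appear in $F$, and let $$R_{\mathrm{equal}}=\Bigl\{(\theta,\tilde\theta)\in\Theta\times\Theta \,\Big|\, \text{there exist } k,\ell\in\{-1\}\cup\mathbb N_0,\ p,q\in\mathbb N_0,\ \xi\in\{x_1,\dots,x_n\}\text{ with }\theta=\sigma_{k\tau}\xi^{(p)},\ \tilde\theta=\sigma_{\ell\tau}\xi^{(q)}\Bigr\}.$$ Then the Pantelides algorithm for DDAEs (described in the context) applied to $F(t,x,\dot x,\sigma_{-\tau}x)=0$ terminates if and only if the DDAE is structurally nonsingular with respect to $\Theta/R_{\mathrm{equal}}$.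
   Context: Structural conventions. Only the information which variable appears in which scalar equation is used. Variables are formal symbols $\sigma_{k\tau}\xi^{(p)}$ with $\xi$ an unknown component, $k\in\{-1\}\cup\mathbb N_0$ the order of shift, $p\in\mathbb N_0$ the order of differentiation. Replacing an equation $E$ by its derivative $\dot E$: the variables appearing in $\dot E$ are those $\sigma_{k\tau}\xi^{(p)}$ appearing in $E$ together with the corresponding $\sigma_{k\tau}\xi^{(p+1)}$ (chain rule). Replacing $E$ by the shifted equation $\sigma_\tau E$: the variables appearing in $\sigma_\tau E$ are exactly the $\sigma_{(k+1)\tau}\xi^{(p)}$ for which $\sigma_{k\tau}\xi^{(p)}$ appears in $E$. Structural singularity. Given a system of equations, a set $\Theta$ of variables and an equivalence relation $R$ on $\Theta$, a subset of $m$ of the equations is structurally singular if $m$ is strictly larger than the number of equivalence classes of $R$ restricted to the set of those elements of $\Theta$ that appear in at least one of these $m$ equations. The system is structurally singular with respect to $\Theta/R$ if it contains a structurally singular subset of equations, and structurally nonsingular otherwise. Matchings. A matching in a bipartite graph (equations versus variable vertices) is a set of edges no two of which share a vertex; a vertex in no matching edge is exposed. An alternating path is a path with distinct vertices that starts with a non-matching edge and alternates between non-matching and matching edges. An augmenting path starting in an exposed equation is an alternating path whose last edge is non-matching and which ends in an exposed variable vertex. The Pantelides algorithm for DDAEs consists of three steps performed one after the other; it terminates if all of them finish after finitely many operations. Step 1 (shifting step). Variable vertices are the equivalence classes $(\xi,k)$ of all present variables $\sigma_{k\tau}\xi^{(p)}$ with the same $\xi$ and $k$ (any $p$); an equation is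 adjacent to $(\xi,k)$ if some element of the class appears in it. Start with the current equations $F_1,\dots,F_M$ and the empty matching. For $r=1,\dots,M$, repeat: (1) keep only the classes $(\xi,k)$ that are highest shifts, i.e. $k\ge0$ and no class $(\xi,k')$ with $k'>k$ is present. (2) Search (depth first) for an augmenting path with respect to the current matching starting in the current $r$-th equation. (3) If one is found, augment the matching along it and continue with $r+1$. (4) Otherwise let $C$ be the set consisting of the current $r$-th equation and all equations reachable from it by an alternating path. First perform the "differentiation during the shifting step" (below), then replace every equation of $C$ (in its differentiated form) by its shifted version, add the newly appearing variables, replace each matching edge between $(\xi,k)$ and an equation of $C$ by the edge between $(\xi,k+1)$ and the shifted equation, and repeat with the same $r$. Differentiation during the shifting step. A connection for the exposed $r$-th equation is a set $P$ of alternating paths $(E,v,E')$ with $E,E'\in C$, $\{v,E'\}$ a matching edge, $\{E,v\}$ a non-matching edge, such that each matching edge $\{v,E'\}$ with $E'\in C$ occurs in exactly one path and such that the graph on $C$ with edges $\{E,E'\}$ for $(E,v,E')\in P$ is connected. For every connection $P$ compute the unique minimizer $\nu^P\in\mathbb N_0^{C}$ of $\sum_{E\in C}\nu_E$ subject to $\nu_E-\nu_{E'}=b_{(E,v,E')}$ for all $(E,v,E')\in P$, where $b_{(E,v,E')}$ is the maximal order of differentiation among the elements of $v$ appearing in $E'$ minus the maximal order of differentiation among the elements of $v$ appearing in $E$. Then differentiate each equation $E\in C$ exactly $\max_P\nu^P_E$ times. Step 2 (trimmed linearization). For each component $x_i$ for which $q_i:=\max\{p\mid \sigma_{k\tau}x_i^{(p)}\text{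 appears for some }k\ge0\}\ge 2$, let $\ell_p:=\max\{k\mid \sigma_{k\tau}x_i^{(q)}\text{ appears in some equation for some }q\ge p\}$, introduce new unknown components $y_{i_1},\dots,y_{i_{q_i-1}}$, replace $\sigma_{k\tau}x_i^{(p)}$ by $\sigma_{k\tau}y_{i_p}$ for $1\le p<q_i$ and $\sigma_{k\tau}x_i^{(q_i)}$ by $\sigma_{k\tau}\dot y_{i_{q_i-1}}$, and add the equations $\sigma_{\ell_1\tau}\dot x_i=\sigma_{\ell_1\tau}y_{i_1}$ and $\sigma_{\ell_p\tau}\dot y_{i_{p-1}}=\sigma_{\ell_p\tau}y_{i_p}$ for $2\le p\le q_i-1$. Step 3 (differentiation step). Only variables $\sigma_{k\tau}\xi^{(p)}$ with $k\ge0$ are considered. Variable vertices are the equivalence classes $[\xi,p]$ of all present variables $\sigma_{k\tau}\xi^{(p)}$, $k\ge0$, with the same $\xi$ and $p$ (any $k\ge 0$); an equation is adjacent to a class if some element of the class appears in it. Start with the empty matching. For $r$ running through all equations resulting from Step 2, repeat: (1) keep only the highest derivatives, i.e. the classes $[\xi,p]$ such that no class $[\xi,p']$ with $p'>p$ is present. (2) Search for an augmenting path starting in the current $r$-th equation. (3) If one is found, augment and continue with the next $r$. (4) Otherwise, with $C$ the set of the $r$-th equation and all equations reachable from it by an alternating path, replace every equation of $C$ by its derivative, add the newly appearing variables, replace each matching edge between $[\xi,p]$ and an equation of $C$ by the edge between $[\xi,p+1]$ and the differentiated equation, and repeat with the same $r$. *)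

theory Defs
  imports Complex_Main
begin

text \<open>Unknown components: \<open>X i\<close> (for \<open>i < n\<close>) is a component of the original unknown, and \<open>Y i p\<close>
  is the component \<open>y\<close> with index \<open>i\<^sub>p\<close> that the trimmed linearization introduces for the \<open>p\<close>-th
  derivative of \<open>X i\<close>.\<close>

datatype component = X nat | Y nat nat

text \<open>The triple \<open>(\<xi>, k, p)\<close> is the formal symbol for the \<open>k\<close>-fold shift of the \<open>p\<close>-th derivative
  of \<open>\<xi>\<close>. Only \<open>k \<ge> -1\<close> ever occurs. A scalar equation is represented by the set of variables that
  appear in it, and a system by a list, since distinct equations may have the same variables.\<close>

type_synonym variable = "component \<times> int \<times> nat"
type_synonym equation = "variable set"

definition variables :: "equation list \<Rightarrow> variable set" where
  "variables F = \<Union> (set F)"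

definition derivative :: "equation \<Rightarrow> equation" where
  "derivative E = E \<union> {(\<xi>, k, Suc p) | \<xi> k p. (\<xi>, k, p) \<in> E}"

definition shifted :: "equation \<Rightarrow> equation" where
  "shifted E = {(\<xi>, k + 1, p) | \<xi> k p. (\<xi>, k, p) \<in> E}"

definition apply_on :: "nat set \<Rightarrow> (nat \<Rightarrow> equation \<Rightarrow> equation) \<Rightarrow> equation list \<Rightarrow> equation list" where
  "apply_on C f F = map (\<lambda>e. if e \<in> C then f e (F ! e) else F ! e) [0..<length F]"

definition ddae_variables :: "nat \<Rightarrow> variable set" where
  "ddae_variables n = (\<Union>i<n. {(X i, 0, 0), (X i, 0, 1), (X i, - 1, 0)})"

definition is_ddae :: "nat \<Rightarrow> equation list \<Rightarrow> bool" where
  "is_ddae n F \<longleftrightarrow> (\<forall>E \<in> set F. E \<subseteq> ddae_variables n)"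


section \<open>Structural singularity\<close>

text \<open>A subset of the equations is given by its set \<open>J\<close> of indices.\<close>

definition structurally_singular_subset ::
  "equation list \<Rightarrow> variable set \<Rightarrow> (variable \<times> variable) set \<Rightarrow> nat set \<Rightarrow> bool" where
  "structurally_singular_subset F \<Theta> R J \<longleftrightarrow>
     J \<subseteq> {..<length F} \<and>
     (let A = \<Theta> \<inter> (\<Union>j\<in>J. F ! j) in card J > card (A // (R \<inter> A \<times> A)))"

definition structurally_singular ::
  "equation list \<Rightarrow> variable set \<Rightarrow> (variable \<times> variable) set \<Rightarrow> bool" where
  "structurally_singular F \<Theta> R \<longleftrightarrow> (\<exists>J. structurally_singular_subset F \<Theta> R J)"

abbreviation structurally_nonsingular ::
  "equation list \<Rightarrow> variable set \<Rightarrow> (variable \<times> variable) set \<Rightarrow> bool" where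
  "structurally_nonsingular F \<Theta> R \<equiv> \<not> structurally_singular F \<Theta> R"

definition R_equal :: "nat \<Rightarrow> variable set \<Rightarrow> (variable \<times> variable) set" where
  "R_equal n \<Theta> = {(\<theta>, \<theta>') \<in> \<Theta> \<times> \<Theta>.
     \<exists>k l p q i. k \<ge> - 1 \<and> l \<ge> - 1 \<and> i < n \<and> \<theta> = (X i, k, p) \<and> \<theta>' = (X i, l, q)}"


section \<open>Bipartite graphs and alternating paths\<close>

text \<open>A graph or a matching is a set of edges \<open>(e, v)\<close> between the equation with index \<open>e\<close> and the
  variable vertex \<open>v\<close>; a path is the list of its vertices.\<close>

datatype 'v vertex = Eqn nat | Var 'v

type_synonym 'v edges = "(nat \<times> 'v) set"

definition joined :: "'v edges \<Rightarrow> 'v vertex \<Rightarrow> 'v vertex \<Rightarrow> bool" where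
  "joined A a b \<longleftrightarrow>
     (\<exists>e v. (e, v) \<in> A \<and> (a = Eqn e \<and> b = Var v \<or> a = Var v \<and> b = Eqn e))"

definition exposed :: "'v edges \<Rightarrow> 'v vertex \<Rightarrow> bool" where
  "exposed m a \<longleftrightarrow> (\<nexists>b. joined m a b)"

definition alternating_path :: "'v edges \<Rightarrow> 'v edges \<Rightarrow> 'v vertex list \<Rightarrow> bool" where
  "alternating_path G m p \<longleftrightarrow> length p \<ge> 2 \<and> distinct p \<and>
     (\<forall>i. Suc i < length p \<longrightarrow> joined (if even i then G - m else G \<inter> m) (p ! i) (p ! Suc i))"

text \<open>The last edge of a path \<open>p\<close> has position \<open>length p - 2\<close>, so in an alternating path it is a
  non-matching edge exactly if \<open>length p\<close> is even.\<close>

definition augmenting_path :: "'v edges \<Rightarrow> 'v edges \<Rightarrow> nat \<Rightarrow> 'v vertex list \<Rightarrow> bool" where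
  "augmenting_path G m e p \<longleftrightarrow>
     alternating_path G m p \<and> hd p = Eqn e \<and> exposed m (Eqn e) \<and>
     even (length p) \<and> (\<exists>v. last p = Var v) \<and> exposed m (last p)"

definition path_edges :: "'v vertex list \<Rightarrow> 'v edges" where
  "path_edges p = {(e, v). \<exists>i. Suc i < length p \<and> {p ! i, p ! Suc i} = {Eqn e, Var v}}"

definition augment :: "'v edges \<Rightarrow> 'v vertex list \<Rightarrow> 'v edges" where
  "augment m p = (m - path_edges p) \<union> (path_edges p - m)"

definition reachable :: "'v edges \<Rightarrow> 'v edges \<Rightarrow> nat \<Rightarrow> nat set" where
  "reachable G m r =
     insert r {e. \<exists>p. alternating_path G m p \<and> hd p = Eqn r \<and> last p = Eqn e}"


section \<open>The matching loop shared by the shifting step and the differentiation step\<close>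

text \<open>A state \<open>(F, V, m, r)\<close> consists of the current equations, the present variables (which are
  only ever added to), the current matching, and the index of the current equation, counted from
  \<open>0\<close>. The loop has finished when \<open>r = length F\<close>.

  The parameter \<open>graph F V\<close> is the graph after deletion of all but the highest classes,
  \<open>update F G m C\<close> replaces the equations in \<open>C\<close>, and \<open>raise v\<close> is the vertex that takes the place of
  \<open>v\<close> in the matching edges at \<open>C\<close>. The search may return any augmenting path; every one of them is
  found by a depth first search that visits the neighbours in a suitable order.\<close>

type_synonym 'v state = "equation list \<times> variable set \<times> 'v edges \<times> nat"

inductive iteration ::
  "(equation list \<Rightarrow> variable set \<Rightarrow> 'v edges) \<Rightarrow>
   (equation list \<Rightarrow> 'v edges \<Rightarrow> 'v edges \<Rightarrow> nat set \<Rightarrow> equation list) \<Rightarrow>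
   ('v \<Rightarrow> 'v) \<Rightarrow> 'v state \<Rightarrow> 'v state \<Rightarrow> bool"
  for graph update raise where
  found: "\<lbrakk> r < length F; augmenting_path (graph F V) m r p \<rbrakk>
    \<Longrightarrow> iteration graph update raise (F, V, m, r) (F, V, augment m p, Suc r)"
| not_found: "\<lbrakk> r < length F; \<nexists>p. augmenting_path (graph F V) m r p;
      C = reachable (graph F V) m r;
      F' = update F (graph F V) m C;
      m' = {(e, v) \<in> m. e \<notin> C} \<union> {(e, raise v) | e v. (e, v) \<in> m \<and> e \<in> C} \<rbrakk>
    \<Longrightarrow> iteration graph update raise (F, V, m, r) (F', V \<union> variables F', m', r)"


section \<open>Shifting step\<close>

text \<open>The vertex \<open>(\<xi>, k)\<close> is the class of all present \<open>(\<xi>, k, p)\<close> with arbitrary \<open>p\<close>.\<close>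

type_synonym shift_class = "component \<times> int"

definition highest_shifts :: "variable set \<Rightarrow> shift_class set" where
  "highest_shifts V =
     {(\<xi>, k). k \<ge> 0 \<and> (\<exists>p. (\<xi>, k, p) \<in> V) \<and> \<not> (\<exists>k' > k. \<exists>p. (\<xi>, k', p) \<in> V)}"

definition shift_graph :: "equation list \<Rightarrow> variable set \<Rightarrow> shift_class edges" where
  "shift_graph F V = {(e, (\<xi>, k)). e < length F \<and> (\<xi>, k) \<in> highest_shifts V \<and>
     (\<exists>p. (\<xi>, k, p) \<in> F ! e)}"

text \<open>The triple \<open>(E, v, E')\<close> stands for the alternating path with these three vertices.\<close>

definition connection ::
  "shift_class edges \<Rightarrow> shift_class edges \<Rightarrow> nat set \<Rightarrow> (nat \<times> shift_class \<times> nat) set \<Rightarrow> bool" where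
  "connection G m C P \<longleftrightarrow>
     (\<forall>(E, v, E') \<in> P. E \<in> C \<and> E' \<in> C \<and> alternating_path G m [Eqn E, Var v, Eqn E']) \<and>
     (\<forall>(E', v) \<in> G \<inter> m. E' \<in> C \<longrightarrow> (\<exists>!E. (E, v, E') \<in> P)) \<and>
     (\<forall>E \<in> C. \<forall>E' \<in> C. (E, E') \<in> {(A, B). \<exists>v. (A, v, B) \<in> P \<or> (B, v, A) \<in> P}\<^sup>*)"

definition max_order :: "equation \<Rightarrow> shift_class \<Rightarrow> nat" where
  "max_order E v = Max {p. (fst v, snd v, p) \<in> E}"

text \<open>Elements of \<open>\<nat>\<^sup>C\<close> are the functions that vanish outside \<open>C\<close>.\<close>

definition differentiation_feasible ::
  "equation list \<Rightarrow> nat set \<Rightarrow> (nat \<times> shift_class \<times> nat) set \<Rightarrow> (nat \<Rightarrow> nat) \<Rightarrow> bool" where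
  "differentiation_feasible F C P \<nu> \<longleftrightarrow>
     (\<forall>E. E \<notin> C \<longrightarrow> \<nu> E = 0) \<and>
     (\<forall>(E, v, E') \<in> P.
        int (\<nu> E) - int (\<nu> E') = int (max_order (F ! E') v) - int (max_order (F ! E) v))"

definition differentiation_minimizer ::
  "equation list \<Rightarrow> nat set \<Rightarrow> (nat \<times> shift_class \<times> nat) set \<Rightarrow> nat \<Rightarrow> nat" where
  "differentiation_minimizer F C P =
     (THE \<nu>. is_arg_min (\<lambda>\<nu>. \<Sum>E\<in>C. \<nu> E) (differentiation_feasible F C P) \<nu>)"

definition differentiation_count ::
  "equation list \<Rightarrow> shift_class edges \<Rightarrow> shift_class edges \<Rightarrow> nat set \<Rightarrow> nat \<Rightarrow> nat" where
  "differentiation_count F G m C E =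
     Max {differentiation_minimizer F C P E | P. connection G m C P}"

definition shift_update ::
  "equation list \<Rightarrow> shift_class edges \<Rightarrow> shift_class edges \<Rightarrow> nat set \<Rightarrow> equation list" where
  "shift_update F G m C =
     apply_on C (\<lambda>e E. shifted ((derivative ^^ differentiation_count F G m C e) E)) F"

definition shifting_iteration :: "shift_class state \<Rightarrow> shift_class state \<Rightarrow> bool" where
  "shifting_iteration = iteration shift_graph shift_update (\<lambda>(\<xi>, k). (\<xi>, k + 1))"


section \<open>Trimmed linearization\<close>

text \<open>The element \<open>0\<close> is inserted only for components of which no variable with \<open>k \<ge> 0\<close> appears;
  these are left unchanged, like all components with \<open>top_order F i < 2\<close>.\<close>

definition top_order :: "equation list \<Rightarrow> nat \<Rightarrow> nat" where
  "top_order F i = Max (insert 0 {p. \<exists>k \<ge> 0. (X i, k, p) \<in> variables F})"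

definition top_shift :: "equation list \<Rightarrow> nat \<Rightarrow> nat \<Rightarrow> int" where
  "top_shift F i p = Max {k. \<exists>q \<ge> p. (X i, k, q) \<in> variables F}"

text \<open>Variables with \<open>k = -1\<close> whose order exceeds \<open>top_order F i\<close> are kept; the differentiation step
  ignores them.\<close>

fun trim_variable :: "equation list \<Rightarrow> variable \<Rightarrow> variable" where
  "trim_variable F (X i, k, p) =
     (if top_order F i \<ge> 2 \<and> 1 \<le> p \<and> p < top_order F i then (Y i p, k, 0)
      else if top_order F i \<ge> 2 \<and> p = top_order F i then (Y i (top_order F i - 1), k, 1)
      else (X i, k, p))"
| "trim_variable F (Y i j, k, p) = (Y i j, k, p)"

definition linking_equations :: "equation list \<Rightarrow> nat \<Rightarrow> equation list" where
  "linking_equations F i =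
     (if top_order F i \<ge> 2
      then {(X i, top_shift F i 1, 1), (Y i 1, top_shift F i 1, 0)}
           # map (\<lambda>p. {(Y i (p - 1), top_shift F i p, 1), (Y i p, top_shift F i p, 0)})
               [2..<top_order F i]
      else [])"

definition trimmed_linearization :: "nat \<Rightarrow> equation list \<Rightarrow> equation list" where
  "trimmed_linearization n F =
     map (\<lambda>E. trim_variable F ` E) F @ concat (map (linking_equations F) [0..<n])"


section \<open>Differentiation step\<close>

text \<open>The vertex \<open>(\<xi>, p)\<close> is the class of all present \<open>(\<xi>, k, p)\<close> with \<open>k \<ge> 0\<close>.\<close>

type_synonym derivative_class = "component \<times> nat"

definition highest_derivatives :: "variable set \<Rightarrow> derivative_class set" where
  "highest_derivatives V =
     {(\<xi>, p). (\<exists>k \<ge> 0. (\<xi>, k, p) \<in> V) \<and> \<not> (\<exists>p' > p. \<exists>k \<ge> 0. (\<xi>, k, p') \<in> V)}"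

definition derivative_graph :: "equation list \<Rightarrow> variable set \<Rightarrow> derivative_class edges" where
  "derivative_graph F V = {(e, (\<xi>, p)). e < length F \<and> (\<xi>, p) \<in> highest_derivatives V \<and>
     (\<exists>k \<ge> 0. (\<xi>, k, p) \<in> F ! e)}"

definition differentiation_iteration :: "derivative_class state \<Rightarrow> derivative_class state \<Rightarrow> bool" where
  "differentiation_iteration =
     iteration derivative_graph (\<lambda>F G m C. apply_on C (\<lambda>e. derivative) F) (\<lambda>(\<xi>, p). (\<xi>, Suc p))"


section \<open>The Pantelides algorithm for DDAEs\<close>

datatype config = Shifting "shift_class state" | Differentiating "derivative_class state"

definition initial_state :: "equation list \<Rightarrow> 'v state" where
  "initial_state F = (F, variables F, {}, 0)"

inductive pantelides_step :: "nat \<Rightarrow> config \<Rightarrow> config \<Rightarrow> bool" for n where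
  shifting: "shifting_iteration s s' \<Longrightarrow> pantelides_step n (Shifting s) (Shifting s')"
| trimming: "r = length F \<Longrightarrow> pantelides_step n (Shifting (F, V, m, r))
    (Differentiating (initial_state (trimmed_linearization n F)))"
| differentiating: "differentiation_iteration s s' \<Longrightarrow>
    pantelides_step n (Differentiating s) (Differentiating s')"

definition finished :: "config \<Rightarrow> bool" where
  "finished c \<longleftrightarrow> (\<exists>F V m r. c = Differentiating (F, V, m, r) \<and> r = length F)"

text \<open>An execution is the sequence of configurations for one particular way of choosing the
  augmenting paths; it stays constant once it has finished.\<close>

definition pantelides_execution :: "nat \<Rightarrow> equation list \<Rightarrow> (nat \<Rightarrow> config) \<Rightarrow> bool" where
  "pantelides_execution n F c \<longleftrightarrow> c 0 = Shifting (initial_state F) \<and>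
     (\<forall>t. if finished (c t) then c (Suc t) = c t else pantelides_step n (c t) (c (Suc t)))"

definition terminates :: "(nat \<Rightarrow> config) \<Rightarrow> bool" where
  "terminates c \<longleftrightarrow> (\<exists>t. finished (c t))"

text \<open>Every system has an execution, since the algorithm can only stop by finishing.\<close>


fun in_range :: "config \<Rightarrow> bool" where
  "in_range (Shifting (F, V, m, r)) \<longleftrightarrow> r \<le> length F"
| "in_range (Differentiating (F, V, m, r)) \<longleftrightarrow> r \<le> length F"

lemma iteration_progress:
  assumes "r < length F"
  shows "\<exists>s'. iteration graph update raise (F, V, m, r) s'"
  using assms by (meson iteration.intros)

lemma iteration_in_range:
  assumes "iteration graph update raise (F, V, m, r) (F', V', m', r')"
    and "\<And>F G m C. length (update F G m C) = length F"
  shows "r' \<le> length F'"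
  using assms by (auto elim!: iteration.cases)

lemma pantelides_step_progress:
  assumes "in_range c" and "\<not> finished c"
  shows "\<exists>c'. pantelides_step n c c'"
proof (cases c)
  case (Shifting s)
  obtain F V m r where s: "s = (F, V, m, r)" by (cases s)
  show ?thesis
  proof (cases "r = length F")
    case True
    then show ?thesis using Shifting s pantelides_step.trimming by blast
  next
    case False
    then have "r < length F" using assms Shifting s by simp
    then show ?thesis
      using Shifting s iteration_progress pantelides_step.shifting
      unfolding shifting_iteration_def by metis
  qed
next
  case (Differentiating s)
  obtain F V m r where s: "s = (F, V, m, r)" by (cases s)
  have "r < length F" using assms Differentiating s by (auto simp: finished_def)
  then show ?thesis
    using Differentiating s iteration_progress pantelides_step.differentiating
    unfolding differentiation_iteration_def by metis
qed

lemma pantelides_step_in_range: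
  assumes "pantelides_step n c c'"
  shows "in_range c'"
  using assms
proof cases
  case (shifting s s')
  then show ?thesis
    by (cases s; cases s')
      (auto simp: shifting_iteration_def shift_update_def apply_on_def dest!: iteration_in_range)
next
  case (differentiating s s')
  then show ?thesis
    by (cases s; cases s')
      (auto simp: differentiation_iteration_def apply_on_def dest!: iteration_in_range)
qed (simp add: initial_state_def)

lemma pantelides_execution_exists: "\<exists>c. pantelides_execution n F c"
proof -
  define next_config where
    "next_config c = (if finished c then c else SOME c'. pantelides_step n c c')" for c
  define c where "c t = (next_config ^^ t) (Shifting (initial_state F))" for t
  have step: "pantelides_step n (c t) (c (Suc t))" if "in_range (c t)" "\<not> finished (c t)" for t
    using someI_ex[OF pantelides_step_progress[OF that]] that(2)
    by (simp add: c_def next_config_def)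
  have stay: "c (Suc t) = c t" if "finished (c t)" for t
    using that by (simp add: c_def next_config_def)
  have "in_range (c t)" for t
  proof (induction t)
    case 0
    then show ?case by (simp add: c_def initial_state_def)
  next
    case (Suc t)
    then show ?case using step stay pantelides_step_in_range by metis
  qed
  then have "pantelides_execution n F c"
    using step stay by (simp add: pantelides_execution_def c_def)
  then show ?thesis by blast
qed

end

theory Submission
  imports Defs
begin

text \<open>
  Call a choice of distinct components, one occurring in each equation, a transversal. By Hall's
  theorem, the system is structurally nonsingular iff it has a transversal. In the shifting step
  shifts and derivatives do not change the components of an equation and every component has at
  most one highest class, so a complete matching at the end of that step is a transversal.

  Conversely, fix a transversal and add up, over all equations, the highest level (order of shift)
  of the component assigned to the equation minus its level in the equation itself. When the search
  for an augmenting path fails, the set \<open>C\<close> has fewer neighbours than elements, so shifting raises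
  fewer highest levels than equation levels and this nonnegative sum decreases. The matching found
  in the shifting step uses only classes with \<open>k \<ge> 0\<close> and extends to the linking equations of the
  trimmed linearization. Hence the same argument, with orders of differentiation as levels, applies
  to the differentiation step.
\<close>

section \<open>Augmenting paths and Hall's theorem\<close>

definition matching :: "'v edges \<Rightarrow> bool" where
  "matching m \<longleftrightarrow> (\<forall>e v e' v'. (e, v) \<in> m \<longrightarrow> (e', v') \<in> m \<longrightarrow> (e = e' \<longleftrightarrow> v = v'))"

lemma joined_simps [simp]:
  "joined A (Eqn e) (Var v) \<longleftrightarrow> (e, v) \<in> A"
  "joined A (Var v) (Eqn e) \<longleftrightarrow> (e, v) \<in> A"
  "\<not> joined A (Eqn e) (Eqn e')"
  "\<not> joined A (Var v) (Var v')"
  by (auto simp: joined_def)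

lemma exposed_Eqn [simp]: "exposed m (Eqn e) \<longleftrightarrow> e \<notin> Domain m"
  by (auto simp: exposed_def joined_def)

lemma exposed_Var [simp]: "exposed m (Var v) \<longleftrightarrow> v \<notin> Range m"
  by (auto simp: exposed_def joined_def)

text \<open>The graph is bipartite and the path starts at an equation, so its positions alternate
  between the two sides.\<close>

lemma alternating_path_parity:
  assumes "alternating_path G m p" and "hd p = Eqn r" and "i < length p"
  shows "if even i then \<exists>e. p ! i = Eqn e else \<exists>v. p ! i = Var v"
  using assms(3)
proof (induction i)
  case 0
  then show ?case using assms(2) by (auto simp: hd_conv_nth)
next
  case (Suc i)
  then have "joined (if even i then G - m else G \<inter> m) (p ! i) (p ! Suc i)"
    using assms(1) by (auto simp: alternating_path_def)
  then show ?case using Suc by (cases "even i"; cases "p ! Suc i") auto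
qed

lemma alternating_path_take:
  assumes "alternating_path G m p" and "1 \<le> i" and "i < length p"
  shows "alternating_path G m (take (Suc i) p)"
  using assms unfolding alternating_path_def by auto

lemma alternating_path_reachable:
  assumes "alternating_path G m p" and "hd p = Eqn r" and "i < length p" and "p ! i = Eqn e"
  shows "e \<in> reachable G m r"
proof (cases "i = 0")
  case True
  then show ?thesis using assms by (auto simp: reachable_def hd_conv_nth)
next
  case False
  then have "alternating_path G m (take (Suc i) p)"
    using assms by (intro alternating_path_take) auto
  moreover have "hd (take (Suc i) p) = Eqn r" "last (take (Suc i) p) = Eqn e"
    using assms hd_take[of "Suc i" p] by (auto simp: take_Suc_conv_app_nth)
  ultimately show ?thesis by (auto simp: reachable_def)
qed

lemma alternating_path_snoc:
  assumes "alternating_path G m p" and "w \<notin> set p"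
    and "joined (if odd (length p) then G - m else G \<inter> m) (last p) w"
  shows "alternating_path G m (p @ [w])"
proof -
  have "p \<noteq> []" using assms(1) by (auto simp: alternating_path_def)
  show ?thesis
    unfolding alternating_path_def
  proof (intro conjI allI impI)
    fix i assume i: "Suc i < length (p @ [w])"
    show "joined (if even i then G - m else G \<inter> m) ((p @ [w]) ! i) ((p @ [w]) ! Suc i)"
    proof (cases "Suc i < length p")
      case True
      then show ?thesis using assms(1) by (auto simp: alternating_path_def nth_append)
    next
      case False
      then have "length p = Suc i" using i by simp
      then show ?thesis using assms(3) \<open>p \<noteq> []\<close> by (auto simp: nth_append last_conv_nth)
    qed
  qed (use assms in \<open>auto simp: alternating_path_def\<close>)
qed

text \<open>The last edge of an alternating path belongs to the graph; \<open>r\<close> counts as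
  reachable even if it is isolated.\<close>

lemma reachable_subset: "reachable G m r \<subseteq> insert r (Domain G)"
proof
  fix e assume "e \<in> reachable G m r"
  then consider "e = r" | p where "alternating_path G m p" "last p = Eqn e"
    by (auto simp: reachable_def)
  then show "e \<in> insert r (Domain G)"
  proof cases
    case 2
    have "2 \<le> length p" using 2(1) by (simp add: alternating_path_def)
    then obtain i where i: "length p = Suc (Suc i)"
      by (metis add_2_eq_Suc le_Suc_ex)
    then have "p ! Suc i = Eqn e" using 2(2) by (cases p rule: rev_cases) (auto simp: nth_append)
    then have "joined (if even i then G - m else G \<inter> m) (p ! i) (Eqn e)"
      using 2(1) i by (metis alternating_path_def lessI)
    then show ?thesis by (cases "p ! i") (auto split: if_splits)
  qed auto
qed

text \<open>If \<open>(e, v)\<close> is a matching edge, \<open>e\<close> is the partner sought.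
  Otherwise an alternating path from \<open>r\<close> reaches \<open>v\<close>. Were
  \<open>v\<close> exposed, that path would be augmenting; so \<open>v\<close> has a partner, and
  following the matching edge shows that the partner is reachable too. It differs from
  \<open>r\<close>, which is exposed.\<close>

lemma matched_in_reachable:
  assumes "r \<notin> Domain m" and no_aug: "\<nexists>p. augmenting_path G m r p" and "m \<subseteq> G"
    and e: "e \<in> reachable G m r" and ev: "(e, v) \<in> G"
  shows "\<exists>e' \<in> reachable G m r - {r}. (e', v) \<in> m"
proof (cases "(e, v) \<in> m")
  case True
  then show ?thesis using assms by auto
next
  case False
  have matched: "v \<in> Range m" if "alternating_path G m p" "hd p = Eqn r" "even (length p)"
      "last p = Var v" for p
    using no_aug that assms(1) by (force simp: augmenting_path_def)
  have "\<exists>p i. alternating_path G m p \<and> hd p = Eqn r \<and> i < length p \<and> p ! i = Var v"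
  proof (cases "e = r")
    case True
    have "alternating_path G m [Eqn r, Var v]"
      using False True ev by (auto simp: alternating_path_def less_Suc_eq)
    then show ?thesis by (intro exI[of _ "[Eqn r, Var v]"] exI[of _ 1]) auto
  next
    case neq: False
    then obtain p where p: "alternating_path G m p" "hd p = Eqn r" "last p = Eqn e"
      using e by (auto simp: reachable_def)
    then have ne: "p \<noteq> []" by (auto simp: alternating_path_def)
    then have odd: "odd (length p)"
      using alternating_path_parity[OF p(1,2), of "length p - 1"] p(3)
      by (auto simp: last_conv_nth split: if_splits)
    \<comment> \<open>If \<open>v\<close> already lies on the path to \<open>e\<close>, appending it
      would repeat a vertex; the prefix ending in \<open>v\<close> serves instead.\<close>
    show ?thesis
    proof (cases "Var v \<in> set p")
      case True
      then show ?thesis using p by (auto simp: in_set_conv_nth)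
    next
      case nin: False
      have "alternating_path G m (p @ [Var v])"
        using p odd nin ev False by (intro alternating_path_snoc) auto
      then show ?thesis
        using p ne by (intro exI[of _ "p @ [Var v]"] exI[of _ "length p"]) auto
    qed
  qed
  then obtain p i where p: "alternating_path G m p" "hd p = Eqn r" "i < length p" "p ! i = Var v"
    by blast
  have "odd i" using alternating_path_parity[OF p(1-3)] p(4) by (auto split: if_splits)
  define q where "q = take (Suc i) p"
  have "1 \<le> i" using \<open>odd i\<close> by (auto intro: Suc_leI odd_pos)
  have q: "alternating_path G m q" "hd q = Eqn r" "even (length q)" "last q = Var v" "q \<noteq> []"
    using p \<open>odd i\<close> \<open>1 \<le> i\<close> alternating_path_take[OF p(1), of i] hd_take[of "Suc i" p]
    unfolding q_def by (auto simp: take_Suc_conv_app_nth)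
  then obtain e' where e': "(e', v) \<in> m" using matched by blast
  have "e' \<in> reachable G m r"
  proof (cases "Eqn e' \<in> set q")
    case True
    then show ?thesis using alternating_path_reachable[OF q(1,2)] by (auto simp: in_set_conv_nth)
  next
    case False
    then have "alternating_path G m (q @ [Eqn e'])"
      using q e' assms(3) by (intro alternating_path_snoc) auto
    then show ?thesis
      using q by (intro alternating_path_reachable[of G m "q @ [Eqn e']" r "length q"]) auto
  qed
  then show ?thesis using e' assms(1) by auto
qed

text \<open>Sending each neighbour to its matching partner is an injection into the reachable
  equations other than \<open>r\<close>. So a failed search exhibits a set that violates Hall's
  condition.\<close>

lemma card_neighbours_reachable:
  assumes "r \<notin> Domain m" and "\<nexists>p. augmenting_path G m r p" and "m \<subseteq> G" and "matching m"
    and "finite (Domain G)"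
  shows "finite (G `` reachable G m r)"
    and "card (G `` reachable G m r) < card (reachable G m r)"
proof -
  let ?C = "reachable G m r"
  have "\<forall>v \<in> G `` ?C. \<exists>e. e \<in> ?C - {r} \<and> (e, v) \<in> m"
    using matched_in_reachable[OF assms(1-3)] by blast
  then obtain f where f: "\<And>v. v \<in> G `` ?C \<Longrightarrow> f v \<in> ?C - {r} \<and> (f v, v) \<in> m" by metis
  have inj: "inj_on f (G `` ?C)"
    using f assms(4) unfolding inj_on_def matching_def by metis
  have fin: "finite ?C" using reachable_subset assms(5) by (metis finite_insert finite_subset)
  have sub: "f ` (G `` ?C) \<subseteq> ?C - {r}" using f by blast
  show "finite (G `` ?C)" using inj sub fin by (metis finite_Diff finite_imageD finite_subset)
  have "card (G `` ?C) \<le> card (?C - {r})" using inj sub fin by (intro card_inj_on_le) auto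
  also have "\<dots> < card ?C" using fin by (intro card_Diff1_less) (auto simp: reachable_def)
  finally show "card (G `` ?C) < card ?C" .
qed

lemma matching_augment:
  assumes "matching m" and "m \<subseteq> G" and aug: "augmenting_path G m r p"
  shows "matching (augment m p)" and "augment m p \<subseteq> G"
    and "Domain (augment m p) = insert r (Domain m)"
proof -
  have p: "alternating_path G m p" "hd p = Eqn r" "even (length p)" "r \<notin> Domain m"
      "exposed m (last p)"
    using aug by (auto simp: augmenting_path_def)
  \<comment> \<open>The path reads \<open>es 0 = r\<close>, \<open>vs 0\<close>,
    \<open>es 1\<close>, ..., \<open>vs (k - 1)\<close>. The edges \<open>(es i, vs i)\<close> are
    non-matching, the edges \<open>(es (Suc i), vs i)\<close> matching.\<close>
  define k where "k = length p div 2"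
  have len: "length p = 2 * k" using p(3) by (simp add: k_def)
  have "k > 0" using p(1) len by (auto simp: alternating_path_def)
  define es where "es i = (THE e. p ! (2 * i) = Eqn e)" for i
  define vs where "vs i = (THE v. p ! Suc (2 * i) = Var v)" for i
  have es: "p ! (2 * i) = Eqn (es i)" if "i < k" for i
    using alternating_path_parity[OF p(1,2), of "2 * i"] that len by (auto simp: es_def)
  have vs: "p ! Suc (2 * i) = Var (vs i)" if "i < k" for i
    using alternating_path_parity[OF p(1,2), of "Suc (2 * i)"] that len by (auto simp: vs_def)
  have step: "joined (if even i then G - m else G \<inter> m) (p ! i) (p ! Suc i)"
    if "Suc i < length p" for i
    using p(1) that by (auto simp: alternating_path_def)
  have new: "(es i, vs i) \<in> G - m" if "i < k" for i
    using step[of "2 * i"] es vs that len by auto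
  have old: "(es (Suc i), vs i) \<in> G \<inter> m" if "Suc i < k" for i
    using step[of "Suc (2 * i)"] es[of "Suc i"] vs[of i] that len by auto
  have es_inj: "i = j" if "es i = es j" "i < k" "j < k" for i j
    using p(1) es[of i] es[of j] that len nth_eq_iff_index_eq[of p "2 * i" "2 * j"]
    by (auto simp: alternating_path_def)
  have vs_inj: "i = j" if "vs i = vs j" "i < k" "j < k" for i j
    using p(1) vs[of i] vs[of j] that len nth_eq_iff_index_eq[of p "Suc (2 * i)" "Suc (2 * j)"]
    by (auto simp: alternating_path_def)
  have es0: "es 0 = r" using es[of 0] p(2) \<open>k > 0\<close> len by (cases p) auto
  have "last p = Var (vs (k - 1))"
    using vs[of "k - 1"] \<open>k > 0\<close> len by (cases k; cases p rule: rev_cases) (auto simp: nth_append)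
  then have vs_last: "vs (k - 1) \<notin> Range m" using p(5) by simp
  have edges: "path_edges p = {(es i, vs i) | i. i < k} \<union> {(es (Suc i), vs i) | i. Suc i < k}"
    (is "_ = ?N \<union> ?O")
  proof (intro equalityI subsetI)
    fix x assume "x \<in> path_edges p"
    then obtain e v i where x: "x = (e, v)" "Suc i < length p" "{p ! i, p ! Suc i} = {Eqn e, Var v}"
      by (auto simp: path_edges_def)
    show "x \<in> ?N \<union> ?O"
    proof (cases "even i")
      case True
      then obtain j where "i = 2 * j" by blast
      then show ?thesis using x es[of j] vs[of j] len by (auto simp: doubleton_eq_iff)
    next
      case False
      then obtain j where "i = Suc (2 * j)" by (auto elim: oddE)
      then show ?thesis using x es[of "Suc j"] vs[of j] len by (auto simp: doubleton_eq_iff)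
    qed
  next
    fix x assume "x \<in> ?N \<union> ?O"
    then consider i where "x = (es i, vs i)" "i < k" | i where "x = (es (Suc i), vs i)" "Suc i < k"
      by blast
    then show "x \<in> path_edges p"
    proof cases
      case 1
      then show ?thesis using es vs len by (auto simp: path_edges_def intro!: exI[of _ "2 * i"])
    next
      case 2
      then show ?thesis using es[of "Suc i"] vs[of i] len
        by (auto simp: path_edges_def doubleton_eq_iff intro!: exI[of _ "Suc (2 * i)"])
    qed
  qed
  have aug_eq: "augment m p = (m - ?O) \<union> ?N"
    unfolding augment_def edges using new old by auto
  \<comment> \<open>Every matching edge at a vertex of the path is one of the removed edges
    \<open>?O\<close>, because both endpoints of the path are exposed and \<open>m\<close> is a
    matching. So the added edges \<open>?N\<close> cannot collide with the surviving ones.\<close>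
  have es_old: "(es i, v) \<in> ?O" if "i < k" "(es i, v) \<in> m" for i v
  proof (cases i)
    case 0
    then show ?thesis using that es0 p(4) by auto
  next
    case (Suc j)
    then have "v = vs j" using old[of j] that assms(1) unfolding matching_def by blast
    then show ?thesis using Suc that by blast
  qed
  have vs_old: "(e, vs i) \<in> ?O" if "i < k" "(e, vs i) \<in> m" for i e
  proof (cases "Suc i < k")
    case True
    then have "e = es (Suc i)" using old[of i] that assms(1) unfolding matching_def by blast
    then show ?thesis using True by blast
  next
    case False
    then have "i = k - 1" using that by simp
    then show ?thesis using vs_last that by auto
  qed
  show "matching (augment m p)"
    unfolding matching_def
  proof (intro allI impI)
    fix e v e' v' assume a: "(e, v) \<in> augment m p" "(e', v') \<in> augment m p"
    consider "(e, v) \<in> m - ?O" "(e', v') \<in> m - ?O" | "(e, v) \<in> m - ?O" "(e', v') \<in> ?N"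
      | "(e, v) \<in> ?N" "(e', v') \<in> m - ?O" | "(e, v) \<in> ?N" "(e', v') \<in> ?N"
      using a unfolding aug_eq by blast
    then show "e = e' \<longleftrightarrow> v = v'"
    proof cases
      case 1
      then show ?thesis using assms(1) unfolding matching_def by blast
    next
      case 2
      then show ?thesis using es_old vs_old by blast
    next
      case 3
      then show ?thesis using es_old vs_old by blast
    next
      case 4
      then show ?thesis using es_inj vs_inj by blast
    qed
  qed
  show "augment m p \<subseteq> G" unfolding aug_eq using assms(2) new by auto
  show "Domain (augment m p) = insert r (Domain m)"
  proof (intro equalityI subsetI)
    fix e assume "e \<in> Domain (augment m p)"
    then consider "e \<in> Domain m" | i where "e = es i" "i < k" unfolding aug_eq by blast
    then show "e \<in> insert r (Domain m)"
    proof cases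
      case (2 i)
      then show ?thesis using es0 old[of "i - 1"] by (cases i) auto
    qed auto
  next
    fix e assume "e \<in> insert r (Domain m)"
    then show "e \<in> Domain (augment m p)"
      unfolding aug_eq using es0 \<open>k > 0\<close> by blast
  qed
qed

text \<open>Equations are matched one at a time. A failed search would exhibit, by
  \<open>card_neighbours_reachable\<close>, a set with too few neighbours.\<close>

lemma hall:
  assumes "Domain G \<subseteq> {..<N}" and "\<And>J. J \<subseteq> {..<N} \<Longrightarrow> card J \<le> card (G `` J)"
  shows "\<exists>m \<subseteq> G. matching m \<and> Domain m = {..<N}"
proof -
  have fin: "finite (Domain G)" using assms(1) finite_subset by blast
  have "r \<le> N \<Longrightarrow> \<exists>m \<subseteq> G. matching m \<and> Domain m = {..<r}" for r
  proof (induction r)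
    case 0
    then show ?case by (intro exI[of _ "{}"]) (auto simp: matching_def)
  next
    case (Suc r)
    then obtain m where m: "m \<subseteq> G" "matching m" "Domain m = {..<r}" by auto
    have "reachable G m r \<subseteq> {..<N}"
      using reachable_subset[of G m r] assms(1) Suc.prems by fastforce
    then have "\<not> card (G `` reachable G m r) < card (reachable G m r)"
      using assms(2) by (simp add: leD)
    then obtain p where "augmenting_path G m r p"
      using card_neighbours_reachable(2)[of r m G] m fin by auto
    from matching_augment[OF m(2,1) this] show ?case
      using m(3) by (intro exI[of _ "augment m p"]) auto
  qed
  then show ?thesis by blast
qed


section \<open>Transversals and Hall's condition\<close>

definition transversal :: "'a set list \<Rightarrow> 'a list \<Rightarrow> bool" where
  "transversal Cs xs \<longleftrightarrow> distinct xs \<and> list_all2 (\<in>) xs Cs"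

text \<open>A transversal injects \<open>J\<close> into the union, whose finiteness matters because
  \<open>card\<close> of an infinite set is 0. Conversely, a complete matching in the membership
  graph is read off as a transversal.\<close>

lemma transversal_iff_hall:
  fixes Cs :: "'a set list"
  assumes "\<And>A. A \<in> set Cs \<Longrightarrow> finite A"
  shows "(\<exists>xs. transversal Cs xs) \<longleftrightarrow>
    (\<forall>J \<subseteq> {..<length Cs}. card J \<le> card (\<Union>j\<in>J. Cs ! j))"
proof
  assume "\<exists>xs. transversal Cs xs"
  then obtain xs where xs: "distinct xs" "list_all2 (\<in>) xs Cs" by (auto simp: transversal_def)
  show "\<forall>J \<subseteq> {..<length Cs}. card J \<le> card (\<Union>j\<in>J. Cs ! j)"
  proof (intro allI impI)
    fix J assume J: "J \<subseteq> {..<length Cs}"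
    then have "finite J" using finite_subset by blast
    then show "card J \<le> card (\<Union>j\<in>J. Cs ! j)"
      using J assms xs
      by (intro card_inj_on_le[of "(!) xs"] finite_UN_I inj_on_nth)
        (force simp: list_all2_conv_all_nth subset_iff)+
  qed
next
  assume cards: "\<forall>J \<subseteq> {..<length Cs}. card J \<le> card (\<Union>j\<in>J. Cs ! j)"
  define G where "G = {(j, x). j < length Cs \<and> x \<in> Cs ! j}"
  have "G `` J = (\<Union>j\<in>J. Cs ! j)" if "J \<subseteq> {..<length Cs}" for J
    using that by (auto simp: G_def)
  then obtain m where m: "m \<subseteq> G" "matching m" "Domain m = {..<length Cs}"
    using hall[of G "length Cs"] cards by (auto simp: G_def)
  then have "\<forall>j < length Cs. \<exists>x. (j, x) \<in> m" by blast
  then obtain f where f: "\<And>j. j < length Cs \<Longrightarrow> (j, f j) \<in> m" by metis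
  have "inj_on f {..<length Cs}"
    using f m(2) unfolding inj_on_def matching_def by (metis lessThan_iff)
  then have "transversal Cs (map f [0..<length Cs])"
    using f m(1) by (auto simp: transversal_def distinct_map list_all2_conv_all_nth G_def
        lessThan_atLeast0)
  then show "\<exists>xs. transversal Cs xs" by blast
qed


section \<open>The matching loop\<close>

text \<open>Both steps only see the components of the classes and their level, the order of shift or of
  differentiation; replacing an equation raises the levels of its classes by one, and may or may
  not keep the old classes.\<close>

locale matching_loop =
  fixes graph :: "equation list \<Rightarrow> variable set \<Rightarrow> 'v edges"
    and update :: "equation list \<Rightarrow> 'v edges \<Rightarrow> 'v edges \<Rightarrow> nat set \<Rightarrow> equation list"
    and raise :: "'v \<Rightarrow> 'v"
    and classes :: "variable set \<Rightarrow> 'v set"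
    and comp :: "'v \<Rightarrow> component"
    and level :: "'v \<Rightarrow> int"
  assumes class_eqI: "comp v = comp w \<Longrightarrow> level v = level w \<Longrightarrow> v = w"
    and comp_raise [simp]: "comp (raise v) = comp v"
    and level_raise [simp]: "level (raise v) = level v + 1"
    and classes_Un: "classes (A \<union> B) = classes A \<union> classes B"
    and classes_variables: "classes (variables F) = (\<Union>E \<in> set F. classes E)"
    and graph_iff: "(e, v) \<in> graph F V \<longleftrightarrow>
      e < length F \<and> v \<in> classes (F ! e) \<and> v \<in> classes V \<and> 0 \<le> level v \<and>
      (\<forall>w \<in> classes V. comp w = comp v \<longrightarrow> level w \<le> level v)"
    and length_update [simp]: "length (update F G m C) = length F"
    and update_outside: "e < length F \<Longrightarrow> e \<notin> C \<Longrightarrow> update F G m C ! e = F ! e"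
    and raise_update:
      "e < length F \<Longrightarrow> e \<in> C \<Longrightarrow> raise ` classes (F ! e) \<subseteq> classes (update F G m C ! e)"
    and update_raise: "e < length F \<Longrightarrow> e \<in> C \<Longrightarrow>
      classes (update F G m C ! e) \<subseteq> classes (F ! e) \<union> raise ` classes (F ! e)"
begin

definition components :: "equation list \<Rightarrow> component set list" where
  "components F = map (\<lambda>E. comp ` classes E) F"

text \<open>\<open>Cs\<close> is a parameter and thus fixed during the loop, so that a transversal
  of the initial system can be used in every later state.\<close>

fun invariant :: "component set list \<Rightarrow> 'v state \<Rightarrow> bool" where
  "invariant Cs (F, V, m, r) \<longleftrightarrow>
     components F = Cs \<and> finite (classes V) \<and> classes (variables F) \<subseteq> classes V \<and>
     matching m \<and> m \<subseteq> graph F V \<and> Domain m = {..<r}"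

text \<open>Only the highest class of a component has edges, and component and level determine a
  class.\<close>

lemma graph_unique:
  assumes "(e, v) \<in> graph F V" and "(e', w) \<in> graph F V" and "comp v = comp w"
  shows "v = w"
  using assms by (intro class_eqI) (auto simp: graph_iff intro: antisym)

lemma classes_in_variables:
  "e < length F \<Longrightarrow> v \<in> classes (F ! e) \<Longrightarrow> v \<in> classes (variables F)"
  by (auto simp: classes_variables)

lemma invariant_initial:
  "finite (classes (variables F)) \<Longrightarrow> invariant (components F) (initial_state F)"
  by (auto simp: initial_state_def matching_def)

text \<open>At the end every equation is matched, and by \<open>graph_unique\<close> distinct
  vertices have distinct components. The restriction to nonnegative levels is recorded because the
  differentiation step only sees nonnegative shifts.\<close>

lemma transversal_of_invariant:
  assumes "invariant Cs (F, V, m, length F)"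
  shows "\<exists>xs. transversal (map (\<lambda>E. comp ` {v \<in> classes E. 0 \<le> level v}) F) xs"
proof -
  have m: "matching m" "m \<subseteq> graph F V" "Domain m = {..<length F}"
    using assms by auto
  then have "\<forall>j < length F. \<exists>v. (j, v) \<in> m" by blast
  then obtain f where f: "\<And>j. j < length F \<Longrightarrow> (j, f j) \<in> m" by metis
  have "inj_on (comp \<circ> f) {..<length F}"
  proof (rule inj_onI)
    fix i j assume a: "i \<in> {..<length F}" "j \<in> {..<length F}" "(comp \<circ> f) i = (comp \<circ> f) j"
    then have "f i = f j"
      using f m(2) graph_unique[of i "f i" F V j "f j"] by auto
    then show "i = j" using a f m(1) unfolding matching_def by (metis lessThan_iff)
  qed
  moreover have "f j \<in> {v \<in> classes (F ! j). 0 \<le> level v}" if "j < length F" for j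
    using f[OF that] m(2) by (auto simp: graph_iff)
  ultimately have "transversal (map (\<lambda>E. comp ` {v \<in> classes E. 0 \<le> level v}) F)
      (map (comp \<circ> f) [0..<length F])"
    by (auto simp: transversal_def distinct_map list_all2_conv_all_nth lessThan_atLeast0)
  then show ?thesis by blast
qed

section \<open>Effect of an unsuccessful search\<close>

context
  fixes F :: "equation list" and V :: "variable set" and m :: "'v edges" and r :: nat
    and Cs :: "component set list" and C :: "nat set" and F' :: "equation list"
  assumes inv: "invariant Cs (F, V, m, r)" and r: "r < length F"
    and no_path: "\<nexists>p. augmenting_path (graph F V) m r p"
    and C_def: "C = reachable (graph F V) m r"
    and F'_def: "F' = update F (graph F V) m C"
begin

lemma current_matching: "matching m" "m \<subseteq> graph F V" "Domain m = {..<r}"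
  using inv by auto

lemma length_F' [simp]: "length F' = length F"
  by (simp add: F'_def)

lemma finite_Domain_graph: "finite (Domain (graph F V))"
  by (rule finite_subset[of _ "{..<length F}"]) (auto simp: graph_iff)

lemma C_subset: "C \<subseteq> {..<length F}"
  using reachable_subset[of "graph F V" m r] r by (auto simp: C_def graph_iff)

lemma classes_C: "e \<in> C \<Longrightarrow> u \<in> classes (F ! e) \<Longrightarrow> u \<in> classes V"
  using C_subset inv classes_in_variables[of e F u] by auto

lemma card_neighbours: "finite (graph F V `` C)" "card (graph F V `` C) < card C"
  using card_neighbours_reachable[OF _ no_path current_matching(2,1) finite_Domain_graph]
    current_matching(3) unfolding C_def by auto

lemma neighbour_partner:
  assumes "e \<in> C" and "(e, v) \<in> graph F V"
  shows "\<exists>e' \<in> C. (e', v) \<in> m"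
  using matched_in_reachable[OF _ no_path current_matching(2)] assms
    current_matching(3) unfolding C_def by blast

lemma classes_F'_cases:
  assumes "v \<in> classes (V \<union> variables F')"
  obtains "v \<in> classes V" | e u where "e \<in> C" "u \<in> classes (F ! e)" "v = raise u"
proof -
  consider "v \<in> classes V" | e where "e < length F" "v \<in> classes (F' ! e)"
    using assms by (auto simp: classes_Un classes_variables in_set_conv_nth)
  then show ?thesis
  proof cases
    case (2 e)
    show ?thesis
    proof (cases "e \<in> C")
      case True
      then have "v \<in> classes (F ! e) \<union> raise ` classes (F ! e)"
        using 2 update_raise unfolding F'_def by blast
      then show ?thesis using that True classes_C by blast
    next
      case False
      then have "v \<in> classes (F ! e)" using 2 by (simp add: F'_def update_outside)
      then show ?thesis using that 2 inv classes_in_variables[of e F v] by auto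
    qed
  qed (use that in blast)
qed

text \<open>Raising preserves components, so the raised classes already cover all components of the
  old equation, and no class of the new one adds another.\<close>

lemma components_F': "components F' = Cs"
proof -
  have "comp ` classes (F' ! e) = comp ` classes (F ! e)" if e: "e < length F" for e
  proof (cases "e \<in> C")
    case True
    have "comp ` classes (F' ! e) \<subseteq> comp ` (classes (F ! e) \<union> raise ` classes (F ! e))"
      unfolding F'_def using update_raise[OF e True] by (intro image_mono)
    moreover have "comp ` raise ` classes (F ! e) \<subseteq> comp ` classes (F' ! e)"
      unfolding F'_def using raise_update[OF e True] by (intro image_mono)
    ultimately show ?thesis by (simp add: image_Un image_image)
  qed (use e in \<open>simp add: F'_def update_outside\<close>)
  then show ?thesis using inv by (auto simp: components_def list_eq_iff_nth_eq)
qed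

lemma finite_classes_F': "finite (classes (V \<union> variables F'))"
proof -
  have "classes (V \<union> variables F') \<subseteq> classes V \<union> raise ` classes V"
  proof
    fix v assume "v \<in> classes (V \<union> variables F')"
    then show "v \<in> classes V \<union> raise ` classes V"
      by (cases rule: classes_F'_cases)
        (use classes_C in auto)
  qed
  then show ?thesis using inv finite_subset by auto
qed

text \<open>\<open>v\<close> was the highest class of its component, and a replacement raises levels
  by at most one, so nothing overtakes \<open>raise v\<close>.\<close>

lemma raised_edge:
  assumes "(e, v) \<in> graph F V" and "e \<in> C"
  shows "(e, raise v) \<in> graph F' (V \<union> variables F')"
proof -
  have "raise v \<in> classes (F' ! e)"
    using assms raise_update unfolding F'_def graph_iff by blast
  moreover have "level w \<le> level v + 1"
    if "w \<in> classes (V \<union> variables F')" "comp w = comp v" for w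
    using that(1)
  proof (cases rule: classes_F'_cases)
    case 1
    then show ?thesis using that assms by (force simp: graph_iff)
  next
    case (2 e' u)
    then have "u \<in> classes V" using classes_C by auto
    then show ?thesis using 2 that assms by (auto simp: graph_iff)
  qed
  ultimately show ?thesis
    using assms by (auto simp: graph_iff classes_Un classes_in_variables)
qed

text \<open>A vertex matched outside \<open>C\<close> has no neighbour in \<open>C\<close>, so it is not overtaken.\<close>

lemma kept_edge:
  assumes "(e, v) \<in> m" and "e \<notin> C"
  shows "(e, v) \<in> graph F' (V \<union> variables F')"
proof -
  have ev: "(e, v) \<in> graph F V" using assms current_matching(2) by blast
  have "level w \<le> level v" if "w \<in> classes (V \<union> variables F')" "comp w = comp v" for w
    using that(1)
  proof (cases rule: classes_F'_cases)
    case 1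
    then show ?thesis using that ev by (auto simp: graph_iff)
  next
    case (2 e' u)
    then have "u \<in> classes V" using classes_C by auto
    then have "level u \<le> level v" using 2 that ev by (auto simp: graph_iff)
    moreover have "level u \<noteq> level v"
    proof
      assume "level u = level v"
      then have "u = v" using 2 that by (intro class_eqI) auto
      then have "(e', v) \<in> graph F V" using 2 ev C_subset by (auto simp: graph_iff)
      then obtain e'' where "e'' \<in> C" "(e'', v) \<in> m" using neighbour_partner 2 by blast
      then show False using assms current_matching(1) unfolding matching_def by blast
    qed
    ultimately show ?thesis using 2 by simp
  qed
  then show ?thesis
    using assms ev by (auto simp: graph_iff classes_Un F'_def update_outside)
qed

lemma invariant_not_found:
  assumes m': "m' = {(e, v) \<in> m. e \<notin> C} \<union> {(e, raise v) | e v. (e, v) \<in> m \<and> e \<in> C}"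
  shows "invariant Cs (F', V \<union> variables F', m', r)"
proof -
  have sub: "m' \<subseteq> graph F' (V \<union> variables F')"
    using current_matching(2) kept_edge raised_edge unfolding m' by blast
  have m'_m: "\<exists>v'. (e, v') \<in> m \<and> v = (if e \<in> C then raise v' else v')" if "(e, v) \<in> m'" for e v
    using that unfolding m' by auto
  have "matching m'"
    unfolding matching_def
  proof (intro allI impI iffI)
    fix e v e' w assume a: "(e, v) \<in> m'" "(e', w) \<in> m'"
    obtain v' w' where b: "(e, v') \<in> m" "(e', w') \<in> m"
        "v = (if e \<in> C then raise v' else v')" "w = (if e' \<in> C then raise w' else w')"
      using m'_m a by metis
    { assume "e = e'"
      then show "v = w" using b current_matching(1) unfolding matching_def by metis }
    \<comment> \<open>Possibly only one of the two vertices was raised, so \<open>v = w\<close>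
      yields no more than equal components; \<open>graph_unique\<close> for the old graph then
      recovers \<open>v' = w'\<close>.\<close>
    { assume "v = w"
      then have "comp v' = comp w'" using b comp_raise by metis
      then have "v' = w'" using graph_unique b(1,2) current_matching(2) by blast
      then show "e = e'" using b(1,2) current_matching(1) unfolding matching_def by blast }
  qed
  moreover have "Domain m' = Domain m" unfolding m' by blast
  ultimately show ?thesis
    using sub components_F' finite_classes_F' current_matching(3) by (auto simp: classes_Un)
qed

end

lemma invariant_iteration:
  assumes "iteration graph update raise s s'" and "invariant Cs s"
  shows "invariant Cs s'"
  using assms(1)
proof cases
  case (found r F V m p)
  then show ?thesis
    using assms(2) matching_augment[of m "graph F V" r p] by (auto simp: lessThan_Suc)
next
  case (not_found r F V m C F' m')
  then show ?thesis using assms(2) invariant_not_found by blast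
qed

section \<open>The decreasing potential\<close>

text \<open>The truncation at \<open>0\<close> accounts for components of which only classes of negative level are
  present: raising such a class is not reflected by a matching edge.\<close>

definition top_level :: "variable set \<Rightarrow> component \<Rightarrow> int" where
  "top_level V x = Max (insert 0 (level ` {v \<in> classes V. comp v = x}))"

text \<open>The maximum is meaningful only for components that occur in \<open>E\<close>; a
  transversal selects such components.\<close>

definition equation_level :: "equation \<Rightarrow> component \<Rightarrow> int" where
  "equation_level E x = Max (level ` {v \<in> classes E. comp v = x})"

definition gap :: "component list \<Rightarrow> equation list \<Rightarrow> variable set \<Rightarrow> int" where
  "gap xs F V = (\<Sum>e<length F. top_level V (xs ! e) - equation_level (F ! e) (xs ! e))"

lemma le_top_level: "finite (classes V) \<Longrightarrow> v \<in> classes V \<Longrightarrow> level v \<le> top_level V (comp v)"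
  unfolding top_level_def by (intro Max_ge) auto

lemma top_level_nonneg: "finite (classes V) \<Longrightarrow> 0 \<le> top_level V x"
  unfolding top_level_def by (intro Max_ge) auto

lemma equation_level_attained:
  assumes "finite (classes E)" and "x \<in> comp ` classes E"
  obtains v where "v \<in> classes E" and "comp v = x" and "level v = equation_level E x"
proof -
  have "equation_level E x \<in> level ` {v \<in> classes E. comp v = x}"
    using assms unfolding equation_level_def by (intro Max_in) auto
  then show ?thesis using that by auto
qed

lemma le_equation_level:
  "finite (classes E) \<Longrightarrow> v \<in> classes E \<Longrightarrow> level v \<le> equation_level E (comp v)"
  unfolding equation_level_def by (intro Max_ge) auto

lemma transversal_in_classes:
  assumes "invariant Cs (F, V, m, r)" and "transversal Cs xs" and "e < length F"
  shows "finite (classes (F ! e))" and "xs ! e \<in> comp ` classes (F ! e)"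
    and "classes (F ! e) \<subseteq> classes V"
proof -
  show sub: "classes (F ! e) \<subseteq> classes V" using assms classes_in_variables by fastforce
  then show "finite (classes (F ! e))" using assms(1) finite_subset by auto
  show "xs ! e \<in> comp ` classes (F ! e)"
    using assms by (auto simp: transversal_def components_def list_all2_conv_all_nth)
qed

lemma gap_nonneg:
  assumes "invariant Cs (F, V, m, r)" and "transversal Cs xs"
  shows "0 \<le> gap xs F V"
  unfolding gap_def
proof (rule sum_nonneg)
  fix e assume "e \<in> {..<length F}"
  then have e: "e < length F" by simp
  note in_classes = transversal_in_classes[OF assms e]
  from equation_level_attained[OF in_classes(1,2)] obtain v
    where "v \<in> classes (F ! e)" "comp v = xs ! e" "level v = equation_level (F ! e) (xs ! e)" .
  then show "0 \<le> top_level V (xs ! e) - equation_level (F ! e) (xs ! e)"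
    using le_top_level[of V v] in_classes(3) assms(1) by auto
qed

text \<open>A top level rises by at most one, and only for components of neighbours of
  \<open>C\<close>, while the level of each equation in \<open>C\<close> rises by at least one. As
  \<open>xs\<close> is distinct, the sum gains at most the number of neighbours of \<open>C\<close>
  and loses at least \<open>card C\<close>, which is larger.\<close>

lemma gap_not_found:
  assumes inv: "invariant Cs (F, V, m, r)" and xs: "transversal Cs xs" and "r < length F"
    and no_path: "\<nexists>p. augmenting_path (graph F V) m r p"
    and C: "C = reachable (graph F V) m r" and F': "F' = update F (graph F V) m C"
  shows "gap xs F' (V \<union> variables F') < gap xs F V"
proof -
  note ctx = inv \<open>r < length F\<close> no_path C F'
  let ?V' = "V \<union> variables F'" and ?N = "comp ` (graph F V `` C)"
  note fin = finite_classes_F'[OF ctx] and C_sub = C_subset[OF ctx]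
  have fin_V: "finite (classes V)" using inv by auto
  have inv': "\<exists>m'. invariant Cs (F', ?V', m', r)" using invariant_not_found[OF ctx] by blast
  have len: "length F' = length F" by (simp add: F')
  have len_xs: "length xs = length F"
    using xs inv by (auto simp: transversal_def components_def list_all2_conv_all_nth)
  have top: "top_level ?V' x \<le> top_level V x + (if x \<in> ?N then 1 else 0)" for x
    unfolding top_level_def[of ?V']
  proof (subst Max_le_iff)
    show "finite (insert 0 (level ` {v \<in> classes ?V'. comp v = x}))" using fin by simp
    show "\<forall>l \<in> insert 0 (level ` {v \<in> classes ?V'. comp v = x}).
        l \<le> top_level V x + (if x \<in> ?N then 1 else 0)"
    proof
      fix l assume "l \<in> insert 0 (level ` {v \<in> classes ?V'. comp v = x})"
      then consider "l = 0" | v where "v \<in> classes ?V'" "comp v = x" "l = level v" by auto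
      then show "l \<le> top_level V x + (if x \<in> ?N then 1 else 0)"
      proof cases
        case 1
        then show ?thesis using top_level_nonneg[OF fin_V, of x] by simp
      next
        case v: (2 v)
        show ?thesis
          using v(1)
        proof (cases rule: classes_F'_cases[OF ctx, consumes 1])
          case 1
          then show ?thesis using le_top_level[OF fin_V] v by fastforce
        next
          case (2 e u)
          then have u: "u \<in> classes V" using classes_C[OF ctx] by auto
          have le: "level u \<le> top_level V x" using le_top_level[OF fin_V u] 2 v by simp
          show ?thesis
          proof (cases "level u = top_level V x")
            case True
            \<comment> \<open>A raised class that was at the top is a vertex of the graph: it is the
              highest of its component, and its level is nonnegative because
              \<open>top_level\<close> is truncated at 0.\<close>
            have "level w \<le> level u" if "w \<in> classes V" "comp w = comp u" for w
              using le_top_level[OF fin_V that(1)] that(2) True 2(3) v(2) by simp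
            then have "(e, u) \<in> graph F V"
              using 2 u C_sub True top_level_nonneg[OF fin_V, of x] by (auto simp: graph_iff)
            then have "u \<in> graph F V `` C" using 2 by blast
            then have "x \<in> ?N" using 2 v by (metis comp_raise imageI)
            then show ?thesis using le 2 v by simp
          next
            case False
            then show ?thesis using le 2 v by simp
          qed
        qed
      qed
    qed
  qed simp
  have eq: "equation_level (F' ! e) (xs ! e)
      \<ge> equation_level (F ! e) (xs ! e) + (if e \<in> C then 1 else 0)" if e: "e < length F" for e
  proof (cases "e \<in> C")
    case True
    from equation_level_attained[OF transversal_in_classes(1,2)[OF inv xs e]] obtain v
      where v: "v \<in> classes (F ! e)" "comp v = xs ! e"
        "level v = equation_level (F ! e) (xs ! e)" .
    have "raise v \<in> classes (F' ! e)" using raise_update[OF e True] v unfolding F' by blast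
    moreover have "finite (classes (F' ! e))"
      using transversal_in_classes(1) inv' xs e len by metis
    ultimately show ?thesis using le_equation_level[of "F' ! e" "raise v"] v True by simp
  qed (use e in \<open>simp add: F' update_outside\<close>)
  have "gap xs F' ?V' \<le> (\<Sum>e<length F. (top_level V (xs ! e) + (if xs ! e \<in> ?N then 1 else 0))
      - (equation_level (F ! e) (xs ! e) + (if e \<in> C then 1 else 0)))"
    unfolding gap_def len using top eq by (intro sum_mono diff_mono) auto
  also have "\<dots> = gap xs F V + (\<Sum>e<length F. if xs ! e \<in> ?N then 1 else 0)
      - (\<Sum>e<length F. if e \<in> C then 1 else 0)"
    unfolding gap_def by (simp add: sum.distrib sum_subtractf)
  also have "(\<Sum>e<length F. if e \<in> C then 1 else 0 :: int) = int (card C)"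
    using C_sub by (simp add: sum.If_cases Int_absorb1)
  also have "(\<Sum>e<length F. if xs ! e \<in> ?N then 1 else 0 :: int)
      = int (card {e. e < length F \<and> xs ! e \<in> ?N})"
    by (simp add: sum.If_cases lessThan_def Int_def conj_commute)
  also have "card {e. e < length F \<and> xs ! e \<in> ?N} \<le> card ?N"
    using xs len_xs card_neighbours(1)[OF ctx]
    by (intro card_inj_on_le[of "(!) xs"] inj_on_nth) (auto simp: transversal_def)
  also have "card ?N \<le> card (graph F V `` C)"
    using card_neighbours(1)[OF ctx] by (rule card_image_le)
  also have "\<dots> < card C" using card_neighbours(2)[OF ctx] .
  finally show ?thesis by simp
qed

fun remaining :: "component list \<Rightarrow> 'v state \<Rightarrow> nat" where
  "remaining xs (F, V, m, r) = nat (gap xs F V) + (length F - r)"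

text \<open>A successful search leaves the equations and variables, hence the gap, unchanged and
  increments \<open>r\<close>; an unsuccessful one lowers the gap and keeps \<open>r\<close> and the
  number of equations.\<close>

lemma remaining_iteration:
  assumes "iteration graph update raise s s'" and "invariant Cs s" and "transversal Cs xs"
  shows "remaining xs s' < remaining xs s"
  using assms(1)
proof cases
  case (found r F V m p)
  then show ?thesis by simp
next
  case (not_found r F V m C F' m')
  have "gap xs F' (V \<union> variables F') < gap xs F V"
    using not_found assms gap_not_found by blast
  \<comment> \<open>Since \<open>nat\<close> collapses negative values, the strict decrease carries
    over to \<open>nat\<close> only with a nonnegative new gap.\<close>
  moreover have "0 \<le> gap xs F' (V \<union> variables F')"
    using invariant_iteration[OF assms(1,2)] assms(3) gap_nonneg not_found by blast
  moreover have "length F' = length F" using not_found by simp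
  ultimately show ?thesis using not_found by simp
qed

end


section \<open>The two steps as instances of the matching loop\<close>

lemma length_apply_on [simp]: "length (apply_on C f F) = length F"
  by (simp add: apply_on_def)

lemma nth_apply_on: "e < length F \<Longrightarrow> apply_on C f F ! e = (if e \<in> C then f e (F ! e) else F ! e)"
  by (simp add: apply_on_def)

abbreviation shift_classes :: "variable set \<Rightarrow> shift_class set" where
  "shift_classes E \<equiv> (\<lambda>(\<xi>, k, p). (\<xi>, k)) ` E"

abbreviation derivative_classes :: "variable set \<Rightarrow> derivative_class set" where
  "derivative_classes E \<equiv> {(\<xi>, p). \<exists>k \<ge> 0. (\<xi>, k, p) \<in> E}"

text \<open>Differentiation changes only the order, which a shift class forgets. As \<open>d\<close>
  is arbitrary, this covers every value of \<open>differentiation_count\<close>.\<close>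

lemma shift_classes_derivative: "shift_classes ((derivative ^^ d) E) = shift_classes E"
proof (induction d)
  case (Suc d)
  have "shift_classes (derivative E') = shift_classes E'" for E'
    by (force simp: derivative_def)
  then show ?case using Suc by simp
qed simp

lemma shift_classes_shifted: "shift_classes (shifted E) = (\<lambda>(\<xi>, k). (\<xi>, k + 1)) ` shift_classes E"
  by (force simp: shifted_def)

text \<open>A shifted equation has exactly the raised classes; the old ones are lost. Levels can be
  negative here.\<close>

interpretation shift: matching_loop shift_graph shift_update "\<lambda>(\<xi>, k). (\<xi>, k + 1)"
  shift_classes fst snd
proof unfold_locales
  show "(e, v) \<in> shift_graph F V \<longleftrightarrow> e < length F \<and> v \<in> shift_classes (F ! e) \<and>
      v \<in> shift_classes V \<and> 0 \<le> snd v \<and>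
      (\<forall>w \<in> shift_classes V. fst w = fst v \<longrightarrow> snd w \<le> snd v)" for e v F V
    by (cases v) (force simp: shift_graph_def highest_shifts_def not_less)
  show "shift_classes (A \<union> B) = shift_classes A \<union> shift_classes B" for A B
    by (rule image_Un)
  show "shift_classes (variables F) = (\<Union>E \<in> set F. shift_classes E)" for F
    by (simp add: variables_def image_Union)
qed (simp_all add: shift_update_def nth_apply_on shift_classes_shifted shift_classes_derivative
      prod_eq_iff split: prod.splits)

lemma shift_components: "shift.components F = map (image fst) F"
  unfolding shift.components_def by (simp add: image_image case_prod_unfold)

text \<open>A differentiated equation keeps its old classes next to the raised ones, and levels are
  never negative.\<close>

interpretation deriv: matching_loop derivative_graph
  "\<lambda>F G m C. apply_on C (\<lambda>e. derivative) F" "\<lambda>(\<xi>, p). (\<xi>, Suc p)"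
  derivative_classes fst "\<lambda>v. int (snd v)"
proof unfold_locales
  show "(e, v) \<in> derivative_graph F V \<longleftrightarrow> e < length F \<and> v \<in> derivative_classes (F ! e) \<and>
      v \<in> derivative_classes V \<and> 0 \<le> int (snd v) \<and>
      (\<forall>w \<in> derivative_classes V. fst w = fst v \<longrightarrow> int (snd w) \<le> int (snd v))" for e v F V
    by (cases v) (force simp: derivative_graph_def highest_derivatives_def not_less)
qed (force simp: variables_def nth_apply_on derivative_def)+


section \<open>The trimmed linearization\<close>

text \<open>\<open>node i p\<close> stands for the \<open>p\<close>-th derivative of \<open>X i\<close>. The linking equations of \<open>i\<close> form a path
  on the nodes of \<open>i\<close>, so they can be matched to all of them but one, which may be chosen freely.\<close>

definition node :: "nat \<Rightarrow> nat \<Rightarrow> component" where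
  "node i p = (if p = 0 then X i else Y i p)"

lemma node_eq_iff [simp]: "node i p = node j q \<longleftrightarrow> i = j \<and> p = q"
  by (auto simp: node_def)

text \<open>With \<open>X i\<close> as node 0, the first linking equation fits the pattern of the
  others.\<close>

lemma linking_equations_eq:
  "linking_equations F i =
    map (\<lambda>p. {(node i (p - 1), top_shift F i p, 1), (node i p, top_shift F i p, 0)})
      [1..<top_order F i]"
proof (cases "top_order F i \<ge> 2")
  case True
  then have "[1..<top_order F i] = 1 # [2..<top_order F i]"
    using upt_conv_Cons[of 1 "top_order F i"] by (simp add: numeral_2_eq_2)
  then show ?thesis using True by (auto simp: linking_equations_def node_def)
qed (simp add: linking_equations_def)

lemma le_top_order:
  assumes "finite (variables F)" and "(X i, k, p) \<in> variables F" and "0 \<le> k"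
  shows "p \<le> top_order F i"
proof -
  have "{p. \<exists>k \<ge> 0. (X i, k, p) \<in> variables F} \<subseteq> (\<lambda>(\<xi>, k, p). p) ` variables F"
    by force
  then have "finite {p. \<exists>k \<ge> 0. (X i, k, p) \<in> variables F}"
    using assms(1) finite_surj by blast
  then show ?thesis unfolding top_order_def using assms by (intro Max_ge) auto
qed

text \<open>This makes both nodes of a linking equation visible to the differentiation step, which
  ignores negative shifts.\<close>

lemma top_shift_nonneg:
  assumes fin: "finite (variables F)" and "1 \<le> p" and "p < top_order F i"
  shows "0 \<le> top_shift F i p"
proof -
  let ?A = "{p. \<exists>k \<ge> 0. (X i, k, p) \<in> variables F}"
  have "?A \<subseteq> (\<lambda>(\<xi>, k, p). p) ` variables F" by force
  then have "finite ?A" using fin finite_surj by blast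
  then have "top_order F i \<in> insert 0 ?A" unfolding top_order_def by (intro Max_in) auto
  \<comment> \<open>As \<open>top_order F i\<close> exceeds \<open>p\<close> and hence 1, it is not
    the default 0 but is attained by a variable with nonnegative shift.\<close>
  then obtain k where k: "0 \<le> k" "(X i, k, top_order F i) \<in> variables F" using assms by auto
  have "{k. \<exists>q \<ge> p. (X i, k, q) \<in> variables F} \<subseteq> (\<lambda>(\<xi>, k, p). k) ` variables F" by force
  then have "finite {k. \<exists>q \<ge> p. (X i, k, q) \<in> variables F}" using fin finite_surj by blast
  then have "k \<le> top_shift F i p"
    unfolding top_shift_def using k assms(3) by (intro Max_ge) (auto intro: less_imp_le)
  then show ?thesis using k by simp
qed

text \<open>The index \<open>i\<close> and the shift survive the renaming, so an equation matched to
  \<open>X i\<close> in the shifting step can be matched to some node of \<open>i\<close> after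
  trimming.\<close>

lemma trim_variable_node:
  assumes "p \<le> top_order F i"
  shows "\<exists>t q. trim_variable F (X i, k, p) = (node i t, k, q)"
proof -
  consider "top_order F i < 2 \<or> p = 0" | "2 \<le> top_order F i" "1 \<le> p" "p < top_order F i"
    | "2 \<le> top_order F i" "p = top_order F i"
    using assms by linarith
  then show ?thesis
  proof cases
    case 1
    then have "trim_variable F (X i, k, p) = (node i 0, k, p)" by (auto simp: node_def)
    then show ?thesis by blast
  next
    case 2
    then have "trim_variable F (X i, k, p) = (node i p, k, 0)" by (simp add: node_def)
    then show ?thesis by blast
  next
    case 3
    then have "trim_variable F (X i, k, p) = (node i (p - 1), k, 1)" by (simp add: node_def)
    then show ?thesis by blast
  qed
qed

lemma distinct_concat_map:
  assumes "distinct xs" and "\<And>x. x \<in> set xs \<Longrightarrow> distinct (f x)"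
    and "\<And>x y. x \<in> set xs \<Longrightarrow> y \<in> set xs \<Longrightarrow> x \<noteq> y \<Longrightarrow> set (f x) \<inter> set (f y) = {}"
  shows "distinct (concat (map f xs))"
  using assms by (induction xs) fastforce+

lemma list_all2_concat_map:
  assumes "\<And>x. x \<in> set xs \<Longrightarrow> list_all2 P (f x) (g x)"
  shows "list_all2 P (concat (map f xs)) (concat (map g xs))"
  using assms by (induction xs) (auto intro: list_all2_appendI)

text \<open>Each old equation takes one node of the component assigned to it, and the linking
  equations of that component are matched around this node.\<close>

lemma transversal_trimmed_linearization:
  assumes fin: "finite (variables F)"
    and X: "fst ` variables F \<subseteq> X ` {..<n}"
    and tr: "transversal (map (\<lambda>E. fst ` {v \<in> shift_classes E. 0 \<le> snd v}) F) xs"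
  shows "\<exists>ys. transversal (deriv.components (trimmed_linearization n F)) ys"
proof -
  have dist: "distinct xs" and len: "length xs = length F"
    using tr by (auto simp: transversal_def dest: list_all2_lengthD)
  have xs: "\<exists>k p. 0 \<le> k \<and> (xs ! e, k, p) \<in> F ! e" if "e < length F" for e
    using tr that by (force simp: transversal_def list_all2_conv_all_nth)
  have in_F: "a \<in> variables F" if "a \<in> F ! e" "e < length F" for a e
    using that by (auto simp: variables_def)
  have "\<exists>i. x = X i" if x: "x \<in> set xs" for x
  proof -
    obtain e where "e < length F" "x = xs ! e" using x len by (metis in_set_conv_nth)
    then obtain k p where "(x, k, p) \<in> variables F" using xs in_F by blast
    then have "x \<in> fst ` variables F" by (metis fst_conv imageI)
    then show ?thesis using X by blast
  qed
  then obtain "is" where "is": "xs = map X is" by (metis ex_map_conv)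
  let ?h = "\<lambda>E. fst ` derivative_classes E"
  have hI: "\<xi> \<in> ?h E" if "(\<xi>, k, p) \<in> E" "0 \<le> k" for \<xi> k p and E :: equation
    using that by (intro image_eqI[of _ _ "(\<xi>, p)"]) auto
  \<comment> \<open>For a component assigned to no equation this holds vacuously, so that a reserved
    node \<open>t i\<close> can be chosen for all \<open>i\<close> uniformly.\<close>
  define fits where "fits i t \<longleftrightarrow>
      (\<forall>e < length F. is ! e = i \<longrightarrow> node i t \<in> ?h (trim_variable F ` (F ! e)))" for i t
  have "\<exists>t. fits i t" for i
  proof (cases "\<exists>e < length F. is ! e = i")
    case True
    then obtain e where e: "e < length F" "is ! e = i" by blast
    then obtain k p where kp: "0 \<le> k" "(X i, k, p) \<in> F ! e" using xs[OF e(1)] "is" len by auto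
    then obtain t q where t: "trim_variable F (X i, k, p) = (node i t, k, q)"
      using trim_variable_node[OF le_top_order[OF fin]] in_F e(1) by blast
    then have "(node i t, k, q) \<in> trim_variable F ` (F ! e)" using kp by (metis imageI)
    then have "node i t \<in> ?h (trim_variable F ` (F ! e))" using kp(1) by (rule hI)
    moreover have "e' = e" if "e' < length F" "is ! e' = i" for e'
      using that e dist "is" len by (auto simp: distinct_map nth_eq_iff_index_eq)
    ultimately have "fits i t" unfolding fits_def by blast
    then show ?thesis by blast
  next
    case False
    then have "fits i 0" unfolding fits_def by blast
    then show ?thesis by blast
  qed
  then obtain t where t: "\<And>i. fits i (t i)" by metis
  define links where
    "links i = map (\<lambda>p. node i (if p \<le> t i then p - 1 else p)) [1..<top_order F i]" for i
  have links: "\<exists>q. q \<noteq> t i \<and> x = node i q" if "x \<in> set (links i)" for i x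
    using that by (auto simp: links_def)
  have "distinct (map (\<lambda>i. node i (t i)) is @ concat (map links [0..<n]))"
    unfolding distinct_append
  proof (intro conjI distinct_concat_map)
    show "distinct (map (\<lambda>i. node i (t i)) is)"
      using dist "is" by (auto simp: distinct_map inj_on_def)
    show "distinct (links i)" for i
      unfolding links_def distinct_map by (auto simp: inj_on_def split: if_splits)
    show "set (links i) \<inter> set (links j) = {}" if "i \<noteq> j" for i j
      using that by (auto dest!: links)
    have "node i (t i) \<notin> set (links j)" for i j
      by (auto dest!: links)
    then show "set (map (\<lambda>i. node i (t i)) is) \<inter> set (concat (map links [0..<n])) = {}"
      by auto
  qed simp
  moreover have "list_all2 (\<in>) (map (\<lambda>i. node i (t i)) is)
      (map ?h (map (\<lambda>E. trim_variable F ` E) F))"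
    using t[unfolded fits_def] "is" len by (intro list_all2_all_nthI) simp_all
  moreover have "list_all2 (\<in>) (concat (map links [0..<n]))
      (map ?h (concat (map (linking_equations F) [0..<n])))"
    unfolding map_concat map_map
  proof (rule list_all2_concat_map)
    fix i
    have mem: "node i (if p \<le> t i then p - 1 else p)
        \<in> ?h {(node i (p - 1), top_shift F i p, 1), (node i p, top_shift F i p, 0)}"
      if "1 \<le> p" "p < top_order F i" for p
      \<comment> \<open>The lower node appears differentiated once in the linking equation, the
        upper one undifferentiated.\<close>
      by (rule hI[of _ "top_shift F i p" "if p \<le> t i then 1 else 0"])
        (use top_shift_nonneg[OF fin that] in auto)
    show "list_all2 (\<in>) (links i) ((map ?h \<circ> linking_equations F) i)"
      unfolding links_def linking_equations_eq comp_def map_map list.rel_map list_all2_same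
    proof
      fix p assume "p \<in> set [1..<top_order F i]"
      then have "1 \<le> p" "p < top_order F i" by simp_all
      then show "node i (if p \<le> t i then p - 1 else p)
          \<in> ?h {(node i (p - 1), top_shift F i p, 1), (node i p, top_shift F i p, 0)}"
        by (rule mem)
    qed
  qed
  ultimately have "transversal (deriv.components (trimmed_linearization n F))
      (map (\<lambda>i. node i (t i)) is @ concat (map links [0..<n]))"
    by (simp only: transversal_def deriv.components_def trimmed_linearization_def map_append
        list_all2_appendI simp_thms)
  then show ?thesis by (rule exI)
qed


section \<open>Executions\<close>

text \<open>While shifting, the variables are kept finite for the sake of the maxima in the trimmed
  linearization. While differentiating, the transversal of \<open>Cs\<close> gives one direction of
  the theorem, and that of \<open>Ds\<close> makes the differentiation step terminate; trimming
  changes the component sets, hence the new \<open>Ds\<close>.\<close>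

fun config_invariant :: "component set list \<Rightarrow> config \<Rightarrow> bool" where
  "config_invariant Cs (Shifting s) \<longleftrightarrow> shift.invariant Cs s \<and> finite (variables (fst s))"
| "config_invariant Cs (Differentiating s) \<longleftrightarrow>
     (\<exists>xs. transversal Cs xs) \<and> (\<exists>Ds ys. deriv.invariant Ds s \<and> transversal Ds ys)"

lemma finite_derivative: "finite E \<Longrightarrow> finite (derivative E)"
proof -
  assume "finite E"
  moreover have "{(\<xi>, k, Suc p) | \<xi> k p. (\<xi>, k, p) \<in> E} = (\<lambda>(\<xi>, k, p). (\<xi>, k, Suc p)) ` E"
    by force
  ultimately show ?thesis by (simp add: derivative_def)
qed

lemma finite_shifted: "finite E \<Longrightarrow> finite (shifted E)"
proof -
  assume "finite E"
  moreover have "shifted E = (\<lambda>(\<xi>, k, p). (\<xi>, k + 1, p)) ` E"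
    by (force simp: shifted_def)
  ultimately show ?thesis by simp
qed

lemma finite_variables_iff: "finite (variables F) \<longleftrightarrow> (\<forall>E \<in> set F. finite E)"
  unfolding variables_def by (metis List.finite_set Union_upper finite_Union finite_subset)

lemma finite_variables_shift_update:
  assumes "finite (variables F)"
  shows "finite (variables (shift_update F G m C))"
proof -
  have "finite ((derivative ^^ d) E)" if "finite E" for d E
    using that by (induction d) (auto intro: finite_derivative)
  then show ?thesis
    using assms by (auto simp: finite_variables_iff shift_update_def apply_on_def finite_shifted)
qed

lemma finite_variables_shifting:
  assumes "shifting_iteration s s'" and "finite (variables (fst s))"
  shows "finite (variables (fst s'))"
  using assms(1) unfolding shifting_iteration_def
  by cases (use assms(2) finite_variables_shift_update in auto)

lemma finite_variables_trimmed_linearization: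
  assumes "finite (variables F)"
  shows "finite (variables (trimmed_linearization n F))"
  using assms
  by (auto simp: finite_variables_iff trimmed_linearization_def linking_equations_def
      split: if_splits)

lemma transversal_mono:
  assumes "transversal (map f xs) ys" and "\<And>x. x \<in> set xs \<Longrightarrow> f x \<subseteq> g x"
  shows "transversal (map g xs) ys"
  using assms by (auto simp: transversal_def list_all2_conv_all_nth subset_iff)

text \<open>The transition to the differentiation step carries the content: the complete matching of
  the shifting step yields a transversal with nonnegative shifts, hence one of \<open>Cs\<close> and
  one of the trimmed system.\<close>

lemma config_invariant_step:
  assumes step: "pantelides_step n c c'" and inv: "config_invariant Cs c"
    and Cs: "\<Union> (set Cs) \<subseteq> X ` {..<n}"
  shows "config_invariant Cs c'"
  using step
proof cases
  case (shifting s s')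
  then have "shift.invariant Cs s'" "finite (variables (fst s'))"
    using inv shift.invariant_iteration[of s s' Cs] finite_variables_shifting[of s s']
    by (simp_all add: shifting_iteration_def)
  then show ?thesis using shifting by simp
next
  case (trimming r F V m)
  then have inv: "shift.invariant Cs (F, V, m, length F)" and fin: "finite (variables F)"
    using inv by auto
  then obtain xs
    where xs: "transversal (map (\<lambda>E. fst ` {v \<in> shift_classes E. 0 \<le> snd v}) F) xs"
    using shift.transversal_of_invariant by blast
  have "transversal Cs xs"
    using transversal_mono[OF xs, of "\<lambda>E. fst ` shift_classes E"] inv
    by (auto simp: shift.components_def)
  moreover have "fst ` variables F \<subseteq> X ` {..<n}"
  proof -
    have "Cs = map (image fst) F" using inv by (simp add: shift_components)
    then have "fst ` variables F = \<Union> (set Cs)" by (simp add: variables_def image_Union)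
    then show ?thesis using Cs by simp
  qed
  then obtain ys where "transversal (deriv.components (trimmed_linearization n F)) ys"
    using transversal_trimmed_linearization[OF fin _ xs] by blast
  moreover have "finite (derivative_classes (variables (trimmed_linearization n F)))"
    by (rule finite_surj[OF finite_variables_trimmed_linearization[OF fin],
          where f = "\<lambda>(\<xi>, k, p). (\<xi>, p)"]) force
  ultimately show ?thesis using trimming deriv.invariant_initial by auto
next
  case (differentiating s s')
  obtain Ds ys where "deriv.invariant Ds s" "transversal Ds ys" "\<exists>xs. transversal Cs xs"
    using inv differentiating by auto
  moreover have "deriv.invariant Ds s'"
    using calculation(1) differentiating(3) deriv.invariant_iteration[of s s' Ds]
    by (simp add: differentiation_iteration_def)
  ultimately show ?thesis using differentiating by auto
qed

lemma pantelides_step_ShiftingD: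
  "pantelides_step n (Shifting s) (Shifting s') \<Longrightarrow> shifting_iteration s s'"
  by (erule pantelides_step.cases) simp_all

lemma pantelides_step_DifferentiatingD:
  "pantelides_step n (Differentiating s) c \<Longrightarrow>
    \<exists>s'. c = Differentiating s' \<and> differentiation_iteration s s'"
  by (erule pantelides_step.cases) simp_all

lemma no_infinite_descent: "\<not> (\<forall>t. f (Suc t) < (f t :: nat))"
proof
  assume descent: "\<forall>t. f (Suc t) < f t"
  have "f t + t \<le> f 0" for t
  proof (induction t)
    case (Suc t)
    then show ?case using descent[rule_format, of t] by simp
  qed simp
  from this[of "Suc (f 0)"] show False by simp
qed

text \<open>A finished configuration belongs to the differentiation step, where the invariant
  supplies a transversal. Conversely, given a transversal, an execution that never finishes would
  decrease \<open>remaining\<close> forever in one of the two loops.\<close>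

lemma terminates_iff_transversal:
  assumes exec: "pantelides_execution n F c"
    and fin: "finite (variables F)" and X: "fst ` variables F \<subseteq> X ` {..<n}"
  shows "terminates c \<longleftrightarrow> (\<exists>xs. transversal (map (image fst) F) xs)"
proof -
  define Cs where "Cs = map (image fst) F"
  have c0: "c 0 = Shifting (initial_state F)"
    and c_Suc: "if finished (c t) then c (Suc t) = c t else pantelides_step n (c t) (c (Suc t))" for t
    using exec[unfolded pantelides_execution_def, THEN conjunct1]
      exec[unfolded pantelides_execution_def, THEN conjunct2, rule_format] by this+
  have step: "\<not> finished (c t) \<Longrightarrow> pantelides_step n (c t) (c (Suc t))"
    and stay: "finished (c t) \<Longrightarrow> c (Suc t) = c t" for t
    using c_Suc[of t] by simp_all
  have Cs: "\<Union> (set Cs) \<subseteq> X ` {..<n}"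
    using X by (auto simp: Cs_def variables_def)
  have comps: "shift.components F = Cs"
    by (simp add: shift_components Cs_def)
  have inv: "config_invariant Cs (c t)" for t
  proof (induction t)
    case 0
    show ?case using shift.invariant_initial[of F] fin comps c0 by (auto simp: initial_state_def)
  next
    case (Suc t)
    then show ?case using step[of t] stay[of t] config_invariant_step[OF _ _ Cs, of "c t" "c (Suc t)"]
      by (cases "finished (c t)") simp_all
  qed
  show ?thesis
  proof
    assume "terminates c"
    then obtain t s where "c t = Differentiating s" by (auto simp: terminates_def finished_def)
    then show "\<exists>xs. transversal (map (image fst) F) xs" using inv[of t] by (simp add: Cs_def)
  next
    assume "\<exists>xs. transversal (map (image fst) F) xs"
    then obtain xs where xs: "transversal Cs xs" by (auto simp: Cs_def)
    show "terminates c"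
    proof (rule ccontr)
      assume "\<not> terminates c"
      then have not_fin: "\<not> finished (c t)" for t by (auto simp: terminates_def)
      note step = step[OF not_fin]
      have "\<exists>t s. c t = Differentiating s"
      proof (rule ccontr)
        assume "\<nexists>t s. c t = Differentiating s"
        then have "\<forall>t. \<exists>s. c t = Shifting s" by (metis config.exhaust)
        then obtain s where s: "\<And>t. c t = Shifting (s t)" by metis
        have "shift.remaining xs (s (Suc t)) < shift.remaining xs (s t)" for t
          using pantelides_step_ShiftingD[OF step[of t, unfolded s]] inv[of t, unfolded s]
            shift.remaining_iteration[OF _ _ xs]
          by (simp add: shifting_iteration_def)
        then show False using no_infinite_descent[of "\<lambda>t. shift.remaining xs (s t)"] by blast
      qed
      then obtain t\<^sub>0 s\<^sub>0 where "c t\<^sub>0 = Differentiating s\<^sub>0" by blast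
      \<comment> \<open>There is no way back to the shifting step, so from \<open>t\<^sub>0\<close>
        on the execution is a run of the differentiation loop alone.\<close>
      then have "\<exists>s. c (t\<^sub>0 + t) = Differentiating s" for t
      proof (induction t)
        case 0
        then show ?case by (intro exI[of _ s\<^sub>0]) simp
      next
        case (Suc t)
        then show ?case
          using step[of "t\<^sub>0 + t"] pantelides_step_DifferentiatingD by (metis add_Suc_right)
      qed
      then obtain s where s: "\<And>t. c (t\<^sub>0 + t) = Differentiating (s t)" by metis
      have iter: "differentiation_iteration (s t) (s (Suc t))" for t
        using pantelides_step_DifferentiatingD[OF step[of "t\<^sub>0 + t", unfolded s]] s[of "Suc t"]
        by (metis add_Suc_right config.inject(2))
      obtain Ds ys where D: "deriv.invariant Ds (s 0)" "transversal Ds ys"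
        using inv[of t\<^sub>0] s[of 0] by auto
      have invD: "deriv.invariant Ds (s t)" for t
      proof (induction t)
        case (Suc t)
        then show ?case
          using deriv.invariant_iteration iter[of t] unfolding differentiation_iteration_def by blast
      qed (rule D(1))
      have "deriv.remaining ys (s (Suc t)) < deriv.remaining ys (s t)" for t
        using deriv.remaining_iteration[OF _ invD D(2)] iter
        by (simp add: differentiation_iteration_def)
      then show False using no_infinite_descent[of "\<lambda>t. deriv.remaining ys (s t)"] by blast
    qed
  qed
qed

section \<open>Structural singularity as failure of Hall's condition\<close>

text \<open>The classes of the kernel of \<open>f\<close> are its nonempty fibres, one for each
  value.\<close>

lemma card_quotient_kernel: "card (A // {(a, b) \<in> A \<times> A. f a = f b}) = card (f ` A)"
proof -
  have "{(a, b) \<in> A \<times> A. f a = f b} `` {x} = {b \<in> A. f b = f x}" if "x \<in> A" for x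
    using that by auto
  then have "A // {(a, b) \<in> A \<times> A. f a = f b} = (\<lambda>y. {b \<in> A. f b = y}) ` f ` A"
    by (simp add: quotient_def UNION_singleton_eq_range image_image)
  moreover have "inj_on (\<lambda>y. {b \<in> A. f b = y}) (f ` A)"
    by (rule inj_onI) blast
  ultimately show ?thesis by (simp add: card_image)
qed

text \<open>On the variables that appear, \<open>R_equal\<close> is the kernel of
  \<open>fst\<close>. So the classes are counted by components, and nonsingularity is Hall's
  condition for the component sets of the equations.\<close>

lemma structurally_nonsingular_iff_transversal:
  assumes "is_ddae n F" and \<Theta>: "\<Theta> = ddae_variables n \<inter> variables F"
  shows "structurally_nonsingular F \<Theta> (R_equal n \<Theta>) \<longleftrightarrow>
    (\<exists>xs. transversal (map (image fst) F) xs)"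
proof -
  have F: "F ! j \<subseteq> ddae_variables n" "F ! j \<subseteq> variables F" if "j < length F" for j
    using assms that by (auto simp: is_ddae_def variables_def)
  have "finite (ddae_variables n)" by (simp add: ddae_variables_def)
  then have fin: "finite A" if "A \<in> set (map (image fst) F)" for A
    using that assms(1) by (auto simp: is_ddae_def dest: finite_subset)
  have "card (A // (R_equal n \<Theta> \<inter> A \<times> A)) = card (\<Union>j\<in>J. map (image fst) F ! j)"
    if J: "J \<subseteq> {..<length F}" and A: "A = \<Theta> \<inter> (\<Union>j\<in>J. F ! j)" for J A
  proof -
    have "A \<subseteq> ddae_variables n" using A \<Theta> by blast
    then have form: "\<exists>i k p. i < n \<and> - 1 \<le> k \<and> a = (X i, k, p)" if "a \<in> A" for a
      using that by (auto simp: ddae_variables_def)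
    have "(a, b) \<in> R_equal n \<Theta> \<longleftrightarrow> fst a = fst b" if ab: "a \<in> A" "b \<in> A" for a b
    proof -
      obtain i k p where a: "i < n" "- 1 \<le> k" "a = (X i, k, p)" using form ab(1) by blast
      obtain j l q where b: "j < n" "- 1 \<le> l" "b = (X j, l, q)" using form ab(2) by blast
      have "(X i, k, p) \<in> \<Theta>" "(X j, l, q) \<in> \<Theta>" using A a b ab by blast+
      then show ?thesis using a b by (auto simp: R_equal_def)
    qed
    then have R: "R_equal n \<Theta> \<inter> A \<times> A = {(a, b) \<in> A \<times> A. fst a = fst b}" by blast
    have A_eq: "A = (\<Union>j\<in>J. F ! j)" using A J F \<Theta> by blast
    have fst_A: "fst ` (\<Union>j\<in>J. F ! j) = (\<Union>j\<in>J. map (image fst) F ! j)"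
      using J by (force simp: image_UN)
    show ?thesis unfolding R card_quotient_kernel unfolding A_eq fst_A by (rule refl)
  qed
  then have "structurally_singular_subset F \<Theta> (R_equal n \<Theta>) J \<longleftrightarrow>
      J \<subseteq> {..<length F} \<and> card (\<Union>j\<in>J. map (image fst) F ! j) < card J" for J
    unfolding structurally_singular_subset_def Let_def by (metis (no_types, lifting))
  then have "structurally_nonsingular F \<Theta> (R_equal n \<Theta>) \<longleftrightarrow>
      (\<forall>J \<subseteq> {..<length F}. card J \<le> card (\<Union>j\<in>J. map (image fst) F ! j))"
    unfolding structurally_singular_def by (simp add: not_less)
  then show ?thesis using transversal_iff_hall[of "map (image fst) F"] fin by simp
qed

theorem theorem5p1:
  fixes \<tau> :: real and n :: nat and F :: "equation list"
    and \<Theta> :: "variable set" and c :: "nat \<Rightarrow> config"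
  assumes "\<tau> > 0"
    and "is_ddae n F"
    and "\<Theta> = ddae_variables n \<inter> variables F"
    and "pantelides_execution n F c"
  shows "terminates c \<longleftrightarrow> structurally_nonsingular F \<Theta> (R_equal n \<Theta>)"
proof -
  have sub: "variables F \<subseteq> ddae_variables n"
    using assms(2) by (auto simp: is_ddae_def variables_def)
  then have "finite (variables F)"
    by (rule finite_subset) (simp add: ddae_variables_def)
  moreover have "fst ` variables F \<subseteq> X ` {..<n}"
    using sub by (fastforce simp: ddae_variables_def)
  ultimately show ?thesis
    using terminates_iff_transversal[OF assms(4)]
      structurally_nonsingular_iff_transversal[OF assms(2,3)] by simp
qed

end
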